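(* If $n$ is a positive rational number, then \[ \frac{a(e^{-2\pi\sqrt{n}})}{\varphi^2(e^{-\pi\sqrt{n}})} = \frac{1}{3}\bigg(1 + \frac{2\sqrt{2}G_n^3}{G_{9n}^9}\bigg)^{1/4}\bigg(1 + \frac{\sqrt{2}G_{9n}^3}{2G_n^9}\bigg). \]
   Context: For $|q|<1$: $\varphi(q)=\sum_{n=-\infty}^{\infty}q^{n^2}$ and the Borweins' cubic theta function is $a(q)=\sum_{m,n=-\infty}^{\infty}q^{m^2+mn+n^2}$. With $(a;q)_\infty=\prod_{k\ge0}(1-aq^k)$ and $\chi(q)=(-q;q^2)_\infty$, the class invariant is defined for positive rational $n$ by $G_n = 2^{-1/4}q^{-1/24}\chi(q)$ with $q=e^{-\pi\sqrt{n}}$. *)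

theory Defs
  imports "HOL-Analysis.Analysis"
begin

text \<open>The functions of \<open>q\<close> below are meant for \<open>norm q < 1\<close>; the type class covers real and complex
  \<open>q\<close>. The sums over \<open>int\<close> and \<open>int \<times> int\<close> are unordered (equivalently, absolutely convergent) sums,
  and all integer exponents occurring in them are nonnegative.\<close>

definition theta_phi :: "'a \<Rightarrow> 'a::{real_normed_field,banach}" where
  "theta_phi q = (\<Sum>\<^sub>\<infinity>n::int. q powi (n\<^sup>2))"

definition borwein_a :: "'a \<Rightarrow> 'a::{real_normed_field,banach}" where
  "borwein_a q = (\<Sum>\<^sub>\<infinity>(m::int, n::int). q powi (m\<^sup>2 + m * n + n\<^sup>2))"

definition qpochhammer_inf :: "'a \<Rightarrow> 'a \<Rightarrow> 'a::{real_normed_field,banach}" where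
  "qpochhammer_inf a q = (\<Prod>k. 1 - a * q ^ k)"

definition ramanujan_chi :: "'a \<Rightarrow> 'a::{real_normed_field,banach}" where
  "ramanujan_chi q = qpochhammer_inf (- q) (q\<^sup>2)"

definition class_invariant_G :: "rat \<Rightarrow> real" where
  "class_invariant_G n =
     (let q = exp (- pi * sqrt (of_rat n))
      in 2 powr (- 1 / 4) * q powr (- 1 / 24) * ramanujan_chi q)"

end

theory Submission
  imports Defs "HOL-Library.Nat_Bijection"
begin

text \<open>
  Write \<open>A, B\<close> for \<open>\<phi>(q), \<phi>(q\<^sup>3)\<close>, \<open>A', B'\<close> for \<open>\<phi>(-q), \<phi>(-q\<^sup>3)\<close>, and \<open>S, T\<close> for
  \<open>\<Sum> q powi (n\<^sup>2 + n)\<close> at \<open>q\<close> and \<open>q\<^sup>3\<close>. Changes of variables in binary quadratic forms give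
  \<open>A\<^sup>4 = A'\<^sup>4 + q S\<^sup>4\<close>, the modular equation \<open>A B = A' B' + q S T\<close>, and
  \<open>a(q\<^sup>2)\<^sup>2 = A\<^sup>2 B\<^sup>2 - A' B' q S T\<close>. By the triple product, \<open>\<chi>(q) ^ 6 S A' = 2 A\<^sup>2\<close>; and multiplying the
  trisection \<open>\<phi>(t) = \<phi>(t ^ 9) + 2 t F(t\<^sup>3)\<close> over the cube roots \<open>t\<close> of \<open>q\<close> gives
  \<open>A\<^sup>4 / B\<^sup>4 = 1 + 8 X\<close> with \<open>X = q \<chi>(q) ^ 3 / \<chi>(q\<^sup>3) ^ 9\<close>. For \<open>Y = \<chi>(q\<^sup>3) ^ 3 / \<chi>(q) ^ 9\<close> and
  \<open>p = q S T A' B' / (A B)\<^sup>2\<close> algebra then yields \<open>X Y = p / 4\<close> and \<open>X + Y = 1 - 2 p\<close>, hence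
  \<open>9 B\<^sup>4 / A\<^sup>4 = 1 + 8 Y\<close> and \<open>a(q\<^sup>2) = (A\<^sup>4 + 3 B\<^sup>4) / (4 A B)\<close>, which is the claim.
\<close>

subsection \<open>Theta series\<close>

text \<open>The term is the \<open>n\<close>-th power of \<open>r ^ n * s\<close>, whose base tends
  to 0 and so is eventually below 1/2; a geometric series dominates from there on.\<close>

lemma summable_power_square_mult_power:
  fixes r s :: real
  assumes "0 \<le> r" "r < 1" "0 \<le> s"
  shows "summable (\<lambda>n. r ^ (n\<^sup>2) * s ^ n)"
proof (rule summable_comparison_test_ev)
  have "(\<lambda>n. r ^ n * s) \<longlonglongrightarrow> 0 * s"
    using assms by (intro tendsto_mult LIMSEQ_power_zero tendsto_const) auto
  then have "eventually (\<lambda>n. r ^ n * s < 1/2) sequentially"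
    by (intro order_tendstoD) auto
  then show "eventually (\<lambda>n. norm (r ^ (n\<^sup>2) * s ^ n) \<le> (1/2) ^ n) sequentially"
  proof eventually_elim
    case (elim n)
    have "r ^ (n\<^sup>2) * s ^ n = (r ^ n * s) ^ n"
      by (simp add: power_mult_distrib power_mult power2_eq_square)
    also have "\<dots> \<le> (1/2) ^ n"
      using elim assms by (intro power_mono) auto
    finally show ?case using assms by simp
  qed
qed (simp add: summable_geometric)

lemma summable_on_intI:
  fixes f :: "int \<Rightarrow> real"
  assumes "\<And>n. f n \<ge> 0" "summable (\<lambda>n. f (int n))" "summable (\<lambda>n. f (- int n))"
  shows "f summable_on UNIV"
proof -
  have "f summable_on range int"
    using assms by (subst summable_on_reindex)
      (auto intro!: inj_onI norm_summable_imp_summable_on simp: o_def)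
  moreover have "f summable_on range (\<lambda>n. - int n)"
    using assms by (subst summable_on_reindex)
      (auto intro!: inj_onI norm_summable_imp_summable_on simp: o_def)
  ultimately have "f summable_on (range int \<union> range (\<lambda>n. - int n))"
    by (rule summable_on_union)
  moreover have "range int \<union> range (\<lambda>n. - int n) = UNIV"
    by (auto simp: image_iff) (metis int_cases2)
  ultimately show ?thesis by simp
qed

lemma abs_summable_theta:
  fixes q z :: "'a::{real_normed_field,banach}"
  assumes "norm q < 1" "z \<noteq> 0"
  shows "(\<lambda>n::int. norm (q powi (n\<^sup>2) * z powi n)) summable_on UNIV"
proof (rule summable_on_intI)
  have e: "norm (q powi ((int n)\<^sup>2)) = norm q ^ (n\<^sup>2)" for n
    by (metis norm_power of_nat_power power_int_of_nat)
  show "summable (\<lambda>n. norm (q powi ((int n)\<^sup>2) * z powi (int n)))"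
    using summable_power_square_mult_power[of "norm q" "norm z"] assms
    by (simp add: norm_mult norm_power e)
  show "summable (\<lambda>n. norm (q powi ((- int n)\<^sup>2) * z powi (- int n)))"
    using summable_power_square_mult_power[of "norm q" "norm (inverse z)"] assms
    by (simp add: norm_mult norm_power e power_int_minus norm_inverse power_inverse)
qed auto

definition theta_sum :: "'a \<Rightarrow> 'a \<Rightarrow> 'a::{real_normed_field,banach}" where
  "theta_sum q z = (\<Sum>\<^sub>\<infinity>n::int. q powi (n\<^sup>2) * z powi n)"

text \<open>The exponents are \<open>n\<^sup>2 + n\<close>, so in Ramanujan's notation this is 2
  psi(q^2), where psi(q) is the sum of q^(n(n+1)/2) over n >= 0.\<close>

abbreviation theta_psi2 :: "'a \<Rightarrow> 'a::{real_normed_field,banach}" where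
  "theta_psi2 q \<equiv> theta_sum q q"

lemma theta_phi_eq_theta_sum: "theta_phi q = theta_sum q 1"
  by (simp add: theta_phi_def theta_sum_def)

lemma has_sum_theta:
  fixes q z :: "'a::{real_normed_field,banach}"
  assumes "norm q < 1" "z \<noteq> 0"
  shows "((\<lambda>n::int. q powi (n\<^sup>2) * z powi n) has_sum theta_sum q z) UNIV"
  using abs_summable_summable[OF abs_summable_theta[OF assms]]
  by (simp add: theta_sum_def)

lemma has_sum_product:
  fixes f :: "'i \<Rightarrow> 'a::{real_normed_field,banach}" and g :: "'j \<Rightarrow> 'a"
  assumes "(\<lambda>x. norm (f x)) summable_on A" "(\<lambda>y. norm (g y)) summable_on B"
  assumes "(f has_sum a) A" "(g has_sum b) B"
  shows "((\<lambda>(x, y). f x * g y) has_sum (a * b)) (A \<times> B)"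
proof (rule has_sum_SigmaI)
  show "((\<lambda>y. case (x, y) of (x, y) \<Rightarrow> f x * g y) has_sum (f x * b)) B" for x
    using assms by (auto intro!: has_sum_cmult_right)
  show "((\<lambda>x. f x * b) has_sum (a * b)) A"
    using assms by (auto intro!: has_sum_cmult_left)
  have "(\<lambda>p. norm (case p of (x, y) \<Rightarrow> f x * g y)) summable_on (A \<times> B)"
    using assms(1,2)
    by (subst Infinite_Sum.abs_summable_on_Sigma_iff)
      (auto simp: norm_mult infsum_cmult_right' abs_mult
        intro!: summable_on_cmult_right summable_on_cmult_left)
  then show "(\<lambda>(x, y). f x * g y) summable_on (A \<times> B)"
    by (rule abs_summable_summable)
qed

lemma has_sum_theta_product:
  fixes p q y z :: "'a::{real_normed_field,banach}"
  assumes "norm p < 1" "norm q < 1" "y \<noteq> 0" "z \<noteq> 0"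
  shows "((\<lambda>(m::int, n::int). (p powi (m\<^sup>2) * y powi m) * (q powi (n\<^sup>2) * z powi n))
    has_sum (theta_sum p y * theta_sum q z)) UNIV"
  using has_sum_product[OF abs_summable_theta abs_summable_theta has_sum_theta has_sum_theta,
      of p y q z] assms by simp

lemma power_int_power_left: "(q ^ c) powi k = (q::'a::field) powi (int c * k)"
  by (simp add: power_int_mult)

context
  fixes q :: "'a::{real_normed_field,banach}" and c d :: nat
  assumes q: "q \<noteq> 0" "norm q < 1" and cd: "c > 0" "d > 0"
begin

lemma norm_q_power_less_1: "norm (q ^ c) < 1" "norm (q ^ d) < 1"
  using q cd by (auto simp: norm_power power_less_one_iff)

lemma has_sum_phi_phi:
  "((\<lambda>(m::int, n::int). q powi (int c * m\<^sup>2 + int d * n\<^sup>2))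
    has_sum (theta_phi (q ^ c) * theta_phi (q ^ d))) UNIV"
  using has_sum_theta_product[OF norm_q_power_less_1, of 1 1] q
  by (simp add: theta_phi_eq_theta_sum power_int_power_left power_int_add)

lemma has_sum_psi2_psi2:
  "((\<lambda>(m::int, n::int). q powi (int c * (m\<^sup>2 + m) + int d * (n\<^sup>2 + n)))
    has_sum (theta_psi2 (q ^ c) * theta_psi2 (q ^ d))) UNIV"
  using has_sum_theta_product[OF norm_q_power_less_1, of "q ^ c" "q ^ d"] q
  by (simp add: power_int_power_left power_int_add algebra_simps)

lemma has_sum_psi2_phi:
  "((\<lambda>(m::int, n::int). q powi (int c * (m\<^sup>2 + m) + int d * n\<^sup>2))
    has_sum (theta_psi2 (q ^ c) * theta_phi (q ^ d))) UNIV"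
  using has_sum_theta_product[OF norm_q_power_less_1, of "q ^ c" 1] q
  by (simp add: theta_phi_eq_theta_sum power_int_power_left power_int_add algebra_simps)

end

text \<open>Serves to change variables in a double sum separately on two complementary classes of
  index pairs.\<close>

lemma has_sum_bij_split:
  fixes f :: "'i \<Rightarrow> 'a::topological_comm_monoid_add"
  assumes "bij_betw g UNIV E" "bij_betw h UNIV (- E)"
  assumes "((\<lambda>x. f (g x)) has_sum s) UNIV" "((\<lambda>x. f (h x)) has_sum t) UNIV"
  shows "(f has_sum (s + t)) UNIV"
proof -
  have "(f has_sum s) E" "(f has_sum t) (- E)"
    using assms by (simp_all add: has_sum_reindex_bij_betw)
  then have "(f has_sum (s + t)) (E \<union> - E)"
    by (intro has_sum_Un_disjoint) auto
  then show ?thesis by simp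
qed

abbreviation even_pairs :: "(int \<times> int) set" where
  "even_pairs \<equiv> {(m, n). even (m + n)}"

lemma bij_even_pairs: "bij_betw (\<lambda>(a, b). (a + b, a - b)) UNIV even_pairs"
  by (rule bij_betw_byWitness[where f' = "\<lambda>(m, n). ((m + n) div 2, (m - n) div 2)"])
    (auto elim!: evenE, presburger+)

lemma bij_odd_pairs: "bij_betw (\<lambda>(a, b). (a + b + 1, a - b)) UNIV (- even_pairs)"
  by (rule bij_betw_byWitness[where f' = "\<lambda>(m, n). ((m + n - 1) div 2, (m - n - 1) div 2)"])
    (auto elim!: oddE, presburger+)

text \<open>This is the parametrization of the even pairs followed by n -> -n-1, which flips the
  parity of n and preserves n^2 + n.\<close>

lemma bij_odd_pairs': "bij_betw (\<lambda>(a, b). (a + b, b - a - 1)) UNIV (- even_pairs)"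
  by (rule bij_betw_byWitness[where f' = "\<lambda>(m, n). ((m - n - 1) div 2, (m + n + 1) div 2)"])
    (auto elim!: oddE, presburger+)

lemma has_sum_power_int_shift:
  fixes q :: "'a::{real_normed_field,banach}"
  assumes "((\<lambda>x. q powi d x) has_sum s) A" "q \<noteq> 0" "\<And>x. e x = d x + 1"
  shows "((\<lambda>x. q powi e x) has_sum (q * s)) A"
  using has_sum_cmult_right[OF assms(1), of q] assms(2,3)
  by (simp add: power_int_add mult.commute)

section \<open>Theta identities from changes of variables in binary quadratic forms\<close>

context
  fixes q :: "'a::{real_normed_field,banach}"
  assumes q: "q \<noteq> 0" "norm q < 1"
begin

text \<open>The substitution m = a+b, n = a-b diagonalizes m^2 + n^2 on pairs of equal parity; on
  the other pairs, m = a+b+1 gives 2(a^2+a) + 2(b^2+b) + 1.\<close>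

lemma theta_phi_square:
  "(theta_phi q)\<^sup>2 = (theta_phi (q\<^sup>2))\<^sup>2 + q * (theta_psi2 (q\<^sup>2))\<^sup>2"
proof -
  let ?f = "\<lambda>(m::int, n::int). q powi (m\<^sup>2 + n\<^sup>2)"
  have even: "(a + b)\<^sup>2 + (a - b)\<^sup>2 = int 2 * a\<^sup>2 + int 2 * b\<^sup>2" for a b :: int
    by (simp add: power2_eq_square algebra_simps)
  have "(?f has_sum (theta_phi (q\<^sup>2) * theta_phi (q\<^sup>2) + q * (theta_psi2 (q\<^sup>2) * theta_psi2 (q\<^sup>2)))) UNIV"
  proof (rule has_sum_bij_split[OF bij_even_pairs bij_odd_pairs])
    show "((\<lambda>x. ?f (case x of (a, b) \<Rightarrow> (a + b, a - b))) has_sum theta_phi (q\<^sup>2) * theta_phi (q\<^sup>2)) UNIV"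
      using has_sum_phi_phi[OF q, of 2 2]
      by (simp only: case_prod_unfold fst_conv snd_conv even)
    show "((\<lambda>x. ?f (case x of (a, b) \<Rightarrow> (a + b + 1, a - b))) has_sum q * (theta_psi2 (q\<^sup>2) * theta_psi2 (q\<^sup>2))) UNIV"
      unfolding case_prod_unfold
      by (rule has_sum_power_int_shift[OF has_sum_psi2_psi2[OF q, of 2 2, unfolded case_prod_unfold]])
        (use q in \<open>auto simp: power2_eq_square algebra_simps\<close>)
  qed
  moreover have "(?f has_sum (theta_phi q * theta_phi q)) UNIV"
    using has_sum_phi_phi[OF q, of 1 1] by simp
  ultimately have "theta_phi q * theta_phi q =
      theta_phi (q\<^sup>2) * theta_phi (q\<^sup>2) + q * (theta_psi2 (q\<^sup>2) * theta_psi2 (q\<^sup>2))"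
    by (rule has_sum_unique[symmetric])
  then show ?thesis by (simp only: power2_eq_square)
qed

text \<open>The two parity classes contribute equally because n -> -n-1 exchanges them without
  changing the exponent; this is the factor 2.\<close>

lemma theta_psi2_square: "(theta_psi2 q)\<^sup>2 = 2 * theta_phi (q\<^sup>2) * theta_psi2 (q\<^sup>2)"
proof -
  let ?f = "\<lambda>(m::int, n::int). q powi ((m\<^sup>2 + m) + (n\<^sup>2 + n))"
  have even: "((a + b)\<^sup>2 + (a + b)) + ((a - b)\<^sup>2 + (a - b)) = int 2 * (a\<^sup>2 + a) + int 2 * b\<^sup>2"
    and odd: "((a + b)\<^sup>2 + (a + b)) + ((b - a - 1)\<^sup>2 + (b - a - 1)) = int 2 * (a\<^sup>2 + a) + int 2 * b\<^sup>2"
    for a b :: int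
    by (simp_all add: power2_eq_square algebra_simps)
  let ?s = "theta_psi2 (q\<^sup>2) * theta_phi (q\<^sup>2)"
  have "(?f has_sum (?s + ?s)) UNIV"
  proof (rule has_sum_bij_split[OF bij_even_pairs bij_odd_pairs'])
    show "((\<lambda>x. ?f (case x of (a, b) \<Rightarrow> (a + b, a - b))) has_sum ?s) UNIV"
      using has_sum_psi2_phi[OF q, of 2 2]
      by (simp only: case_prod_unfold fst_conv snd_conv even)
    show "((\<lambda>x. ?f (case x of (a, b) \<Rightarrow> (a + b, b - a - 1))) has_sum ?s) UNIV"
      using has_sum_psi2_phi[OF q, of 2 2]
      by (simp only: case_prod_unfold fst_conv snd_conv odd)
  qed
  moreover have "(?f has_sum (theta_psi2 q * theta_psi2 q)) UNIV"
    using has_sum_psi2_psi2[OF q, of 1 1] by simp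
  ultimately have "theta_psi2 q * theta_psi2 q = ?s + ?s"
    by (rule has_sum_unique[symmetric])
  then show ?thesis by (simp add: power2_eq_square)
qed

text \<open>Completing the square with m = j-k: for n = 2k the form becomes j^2 + 3k^2, for n = 2k+1
  it becomes (j^2+j) + 3(k^2+k) + 1.\<close>

lemma borwein_a_eq:
  "borwein_a q = theta_phi q * theta_phi (q ^ 3) + q * (theta_psi2 q * theta_psi2 (q ^ 3))"
proof -
  let ?f = "\<lambda>(m::int, n::int). q powi (m\<^sup>2 + m * n + n\<^sup>2)"
  have e: "(j - k)\<^sup>2 + (j - k) * (2 * k) + (2 * k)\<^sup>2 = int 1 * j\<^sup>2 + int 3 * k\<^sup>2" for j k :: int
    by (simp add: power2_eq_square algebra_simps)
  have even: "bij_betw (\<lambda>(j, k). (j - k, 2 * k)) UNIV {(m::int, n::int). even n}"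
    by (rule bij_betw_byWitness[where f' = "\<lambda>(m, n). (m + n div 2, n div 2)"]) auto
  have odd: "bij_betw (\<lambda>(j, k). (j - k, 2 * k + 1)) UNIV (- {(m::int, n::int). even n})"
    by (rule bij_betw_byWitness[where f' = "\<lambda>(m, n). (m + n div 2, n div 2)"]) auto
  have "(?f has_sum (theta_phi q * theta_phi (q ^ 3) + q * (theta_psi2 q * theta_psi2 (q ^ 3)))) UNIV"
  proof (rule has_sum_bij_split[OF even odd])
    show "((\<lambda>x. ?f (case x of (j, k) \<Rightarrow> (j - k, 2 * k))) has_sum theta_phi q * theta_phi (q ^ 3)) UNIV"
      using has_sum_phi_phi[OF q, of 1 3]
      by (simp only: case_prod_unfold fst_conv snd_conv e) simp
    show "((\<lambda>x. ?f (case x of (j, k) \<Rightarrow> (j - k, 2 * k + 1))) has_sum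
        q * (theta_psi2 q * theta_psi2 (q ^ 3))) UNIV"
      unfolding case_prod_unfold
      by (rule has_sum_power_int_shift[OF has_sum_psi2_psi2[OF q, of 1 3, unfolded case_prod_unfold, simplified]])
        (use q in \<open>auto simp: power2_eq_square algebra_simps\<close>)
  qed
  then show ?thesis
    unfolding borwein_a_def by (rule infsumI)
qed

text \<open>The terms \<open>m + n\<close> odd on the left are norms of elements of \<open>\<int>[\<surd>-3]\<close>; those of \<open>\<psi>\<close>-type are norms of
  \<open>((2 j + 1) + (2 k + 1) \<surd>-3) / 2\<close>. Multiplication by a primitive cube root of unity maps each of the two
  parity classes of \<open>j + k\<close> onto the former.\<close>
lemma theta_phi_cubic:
  "theta_phi q * theta_phi (q ^ 3) = theta_phi (- q) * theta_phi (- (q ^ 3)) + q * (theta_psi2 q * theta_psi2 (q ^ 3))"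
proof -
  let ?e = "\<lambda>m n :: int. m\<^sup>2 + 3 * n\<^sup>2"
  let ?f = "\<lambda>(m, n). q powi ?e m n"
  let ?g = "\<lambda>(m, n). (- q) powi ?e m n"
  have f: "(?f has_sum (theta_phi q * theta_phi (q ^ 3))) UNIV"
    using has_sum_phi_phi[OF q, of 1 3] by simp
  have g: "(?g has_sum (theta_phi (- q) * theta_phi (- (q ^ 3)))) UNIV"
    using has_sum_phi_phi[of "- q" 1 3] q by simp
  define s t where "s = infsum ?f even_pairs" and "t = infsum ?f (- even_pairs)"
  have s: "(?f has_sum s) even_pairs" and t: "(?f has_sum t) (- even_pairs)"
    unfolding s_def t_def using summable_on_subset_banach[OF has_sum_imp_summable[OF f]]
    by simp_all
  have "(?f has_sum (s + t)) (even_pairs \<union> - even_pairs)"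
    by (intro has_sum_Un_disjoint s t) auto
  then have 1: "theta_phi q * theta_phi (q ^ 3) = s + t"
    using has_sum_unique[OF f] by simp
  \<comment> \<open>The exponent m^2 + 3n^2 has the parity of m + n, so replacing q by -q keeps the
    even part \<open>s\<close> and negates the odd part \<open>t\<close>.\<close>
  have "(?g has_sum s) even_pairs"
    by (rule has_sum_cong[THEN iffD1, OF _ s]) (auto simp: power_int_minus_left)
  moreover have "(?g has_sum (- t)) (- even_pairs)"
    by (rule has_sum_cong[THEN iffD1, OF _ has_sum_uminusI[OF t]])
      (auto simp: power_int_minus_left split: if_splits)
  ultimately have "(?g has_sum (s + - t)) (even_pairs \<union> - even_pairs)"
    by (intro has_sum_Un_disjoint) auto
  then have 2: "theta_phi (- q) * theta_phi (- (q ^ 3)) = s - t"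
    using has_sum_unique[OF g] by simp
  let ?h = "\<lambda>(j::int, k::int). q powi (j\<^sup>2 + j + 3 * (k\<^sup>2 + k) + 1)"
  have h: "(?h has_sum (q * (theta_psi2 q * theta_psi2 (q ^ 3)))) UNIV"
      unfolding case_prod_unfold
      by (rule has_sum_power_int_shift[OF has_sum_psi2_psi2[OF q, of 1 3, unfolded case_prod_unfold, simplified]])
        (use q in \<open>auto simp: power2_eq_square algebra_simps\<close>)
  have e0: "(c + d + 1)\<^sup>2 + 3 * (c - d)\<^sup>2 =
      4 * c\<^sup>2 + 4 * d\<^sup>2 - 4 * c * d + 2 * c + 2 * d + 1" for c d :: int
    by (simp add: power2_eq_square algebra_simps)
  have t': "((\<lambda>(c, d). q powi (4 * c\<^sup>2 + 4 * d\<^sup>2 - 4 * c * d + 2 * c + 2 * d + 1)) has_sum t) UNIV"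
    using has_sum_reindex_bij_betw[OF bij_odd_pairs, THEN iffD2, OF t]
    by (simp only: case_prod_unfold fst_conv snd_conv e0)
  \<comment> \<open>With m = c+d+1 and n = c-d, multiplying m + n sqrt(-3) by (-1-sqrt(-3))/2 gives
    ((3n-m) - (m+n) sqrt(-3))/2. Equating this with ((2j+1) + (2k+1) sqrt(-3))/2 yields j = c-2d-1,
    k = -c-1. The map in \<open>odd\<close> is its complex conjugate, k -> -k-1.\<close>
  have even: "bij_betw (\<lambda>(c, d). (c - 2 * d - 1, - c - 1)) UNIV even_pairs"
    by (rule bij_betw_byWitness[where f' = "\<lambda>(j, k). (- k - 1, (- k - 2 - j) div 2)"])
      (simp_all add: split_def image_subset_iff)
  have odd: "bij_betw (\<lambda>(c, d). (c - 2 * d - 1, c)) UNIV (- even_pairs)"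
    by (rule bij_betw_byWitness[where f' = "\<lambda>(j, k). (k, (k - 1 - j) div 2)"])
      (simp_all add: split_def image_subset_iff)
  have e1: "(c - 2 * d - 1)\<^sup>2 + (c - 2 * d - 1) + 3 * ((- c - 1)\<^sup>2 + (- c - 1)) + 1 =
      4 * c\<^sup>2 + 4 * d\<^sup>2 - 4 * c * d + 2 * c + 2 * d + 1"
    and e2: "(c - 2 * d - 1)\<^sup>2 + (c - 2 * d - 1) + 3 * (c\<^sup>2 + c) + 1 =
      4 * c\<^sup>2 + 4 * d\<^sup>2 - 4 * c * d + 2 * c + 2 * d + 1" for c d :: int
    by (simp_all add: power2_eq_square algebra_simps)
  have "(?h has_sum (t + t)) UNIV"
  proof (rule has_sum_bij_split[OF even odd])
    show "((\<lambda>x. ?h (case x of (c, d) \<Rightarrow> (c - 2 * d - 1, - c - 1))) has_sum t) UNIV"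
      using t' by (simp only: case_prod_unfold fst_conv snd_conv e1)
    show "((\<lambda>x. ?h (case x of (c, d) \<Rightarrow> (c - 2 * d - 1, c))) has_sum t) UNIV"
      using t' by (simp only: case_prod_unfold fst_conv snd_conv e2)
  qed
  then have "q * (theta_psi2 q * theta_psi2 (q ^ 3)) = t + t"
    using h has_sum_unique by blast
  with 1 2 show ?thesis by simp
qed

end

subsection \<open>Infinite products\<close>

lemma convergent_prod_qpochhammer:
  fixes a q :: "'a::{real_normed_field,banach}"
  assumes "norm q < 1"
  shows "convergent_prod (\<lambda>k. 1 - a * q ^ k)"
proof (rule abs_convergent_prod_imp_convergent_prod, rule summable_imp_abs_convergent_prod)
  show "summable (\<lambda>k. norm (1 - a * q ^ k - 1))"
    using assms by (auto simp: norm_mult norm_power intro!: summable_mult summable_geometric)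
qed

lemma qpochhammer_inf_LIMSEQ:
  fixes a q :: "'a::{real_normed_field,banach}"
  assumes "norm q < 1"
  shows "(\<lambda>n. \<Prod>k<n. 1 - a * q ^ k) \<longlonglongrightarrow> qpochhammer_inf a q"
  using convergent_prod_LIMSEQ[OF convergent_prod_qpochhammer[OF assms]]
  unfolding qpochhammer_inf_def by (simp only: LIMSEQ_lessThan_iff_atMost)

lemma qpochhammer_inf_nonzero:
  fixes a q :: "'a::{real_normed_field,banach}"
  assumes "norm q < 1" "norm a < 1"
  shows "qpochhammer_inf a q \<noteq> 0"
  unfolding qpochhammer_inf_def
proof (rule prodinf_nonzero[OF convergent_prod_qpochhammer[OF assms(1)]])
  fix k
  have "norm (a * q ^ k) \<le> norm a * 1"
    unfolding norm_mult norm_power using assms by (intro mult_left_mono power_le_one) auto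
  then have "norm (a * q ^ k) \<noteq> norm (1 :: 'a)" using assms by simp
  then show "1 - a * q ^ k \<noteq> 0" by force
qed

lemma qpochhammer_inf_pos:
  fixes a q :: real
  assumes "0 \<le> q" "q < 1" "a < 1"
  shows "qpochhammer_inf a q > 0"
proof -
  have pos: "1 - a * q ^ k > 0" for k
  proof (cases "a \<ge> 0")
    case True
    then have "a * q ^ k \<le> a * 1"
      using assms by (intro mult_left_mono power_le_one) auto
    then show ?thesis using assms by simp
  next
    case False
    then have "a * q ^ k \<le> 0" using assms by (simp add: mult_le_0_iff)
    then show ?thesis by simp
  qed
  have conv: "convergent_prod (\<lambda>k. 1 - a * q ^ k)"
    using assms by (intro convergent_prod_qpochhammer) auto
  have "qpochhammer_inf a q \<noteq> 0"
    unfolding qpochhammer_inf_def using conv pos by (intro prodinf_nonzero) (auto simp: less_le)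
  moreover have "qpochhammer_inf a q \<ge> 0"
    using qpochhammer_inf_LIMSEQ[of q a] assms pos
    by (intro LIMSEQ_le_const) (auto intro!: exI[of _ 0] prod_nonneg simp: less_imp_le)
  ultimately show ?thesis by simp
qed

text \<open>The factors are sorted by the residue of their index modulo \<open>m\<close>; it
  suffices to compare partial products with \<open>n * m\<close> factors.\<close>

lemma qpochhammer_inf_split:
  fixes a q :: "'a::{real_normed_field,banach}"
  assumes q: "norm q < 1" and m: "m > 0"
  shows "qpochhammer_inf a q = (\<Prod>i<m. qpochhammer_inf (a * q ^ i) (q ^ m))"
proof (rule LIMSEQ_unique)
  have "strict_mono (\<lambda>n. n * m)"
    using m by (auto simp: strict_mono_def)
  from LIMSEQ_subseq_LIMSEQ[OF qpochhammer_inf_LIMSEQ[OF q, of a] this]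
  show "(\<lambda>n. \<Prod>k<n * m. 1 - a * q ^ k) \<longlonglongrightarrow> qpochhammer_inf a q"
    by (simp add: o_def)
  have "(\<Prod>k<n * m. 1 - a * q ^ k) = (\<Prod>i<m. \<Prod>k<n. 1 - (a * q ^ i) * (q ^ m) ^ k)" for n
  proof -
    have "(\<Prod>k<n * m. 1 - a * q ^ k) = (\<Prod>k<n. \<Prod>i=k * m..<k * m + m. 1 - a * q ^ i)"
      by (rule prod.nat_group[symmetric])
    also have "\<dots> = (\<Prod>k<n. \<Prod>i<m. 1 - a * q ^ (i + k * m))"
    proof (rule prod.cong[OF refl])
      fix k
      show "(\<Prod>i = k * m..<k * m + m. 1 - a * q ^ i) = (\<Prod>i<m. 1 - a * q ^ (i + k * m))"
        using prod.shift_bounds_nat_ivl[of "\<lambda>k. 1 - a * q ^ k" 0 "k * m" m]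
        by (simp only: atLeast0LessThan add.commute add_0 add_0_right)
    qed
    also have "\<dots> = (\<Prod>i<m. \<Prod>k<n. 1 - a * q ^ (i + k * m))"
      by (rule prod.swap)
    finally show ?thesis
      by (simp only: power_add power_mult mult.commute[of _ m] mult.assoc)
  qed
  moreover have "norm (q ^ m) < 1"
    using q m by (simp add: norm_power power_less_one_iff)
  ultimately show "(\<lambda>n. \<Prod>k<n * m. 1 - a * q ^ k) \<longlonglongrightarrow> (\<Prod>i<m. qpochhammer_inf (a * q ^ i) (q ^ m))"
    by (auto intro!: tendsto_prod qpochhammer_inf_LIMSEQ)
qed

lemma qpochhammer_inf_mult_minus:
  fixes a q :: "'a::{real_normed_field,banach}"
  assumes q: "norm q < 1"
  shows "qpochhammer_inf a q * qpochhammer_inf (- a) q = qpochhammer_inf (a\<^sup>2) (q\<^sup>2)"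
  unfolding qpochhammer_inf_def
proof (subst prodinf_mult)
  show "(\<Prod>k. (1 - a * q ^ k) * (1 - - a * q ^ k)) = (\<Prod>k. 1 - a\<^sup>2 * (q\<^sup>2) ^ k)"
    by (intro prodinf_cong) (simp add: algebra_simps power2_eq_square power_mult_distrib)
qed (rule convergent_prod_qpochhammer[OF q])+

text \<open>Lets identities proved with complex cube roots of unity be read off for real
  arguments.\<close>

lemma qpochhammer_inf_of_real:
  assumes "\<bar>q\<bar> < 1"
  shows "qpochhammer_inf (of_real a) (of_real q) =
    (of_real (qpochhammer_inf a q) :: 'a::{real_normed_field,banach})"
proof (rule LIMSEQ_unique)
  show "(\<lambda>n. \<Prod>k<n. 1 - of_real a * of_real q ^ k) \<longlonglongrightarrow> (qpochhammer_inf (of_real a) (of_real q) :: 'a)"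
    using assms by (intro qpochhammer_inf_LIMSEQ) simp
  have "(\<lambda>n. of_real (\<Prod>k<n. 1 - a * q ^ k)) \<longlonglongrightarrow> (of_real (qpochhammer_inf a q) :: 'a)"
    using assms by (intro tendsto_of_real qpochhammer_inf_LIMSEQ) simp
  then show "(\<lambda>n. \<Prod>k<n. 1 - of_real a * of_real q ^ k) \<longlonglongrightarrow> (of_real (qpochhammer_inf a q) :: 'a)"
    by simp
qed

text \<open>Tannery's theorem carried over to sums over the integers by the enumeration
  \<open>int_decode\<close>; it justifies the limit in the triple product.\<close>

lemma tendsto_infsum_dominated:
  fixes f :: "nat \<Rightarrow> int \<Rightarrow> 'a::{real_normed_field,banach}"
  assumes lim: "\<And>j. (\<lambda>n. f n j) \<longlonglongrightarrow> g j"
    and bound: "\<And>n j. norm (f n j) \<le> h j" and h: "h summable_on UNIV"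
  shows "(\<lambda>n. infsum (f n) UNIV) \<longlonglongrightarrow> infsum g UNIV"
proof -
  have bij: "bij_betw int_decode UNIV UNIV" by (rule bij_int_decode)
  have gh: "norm (g j) \<le> h j" for j
    by (rule Lim_bounded[OF tendsto_norm[OF lim], where M = 0]) (simp add: bound)
  have eq: "infsum u UNIV = (\<Sum>k. u (int_decode k))"
    if "\<And>j. norm (u j) \<le> h j" for u :: "int \<Rightarrow> 'a"
  proof -
    have "(\<lambda>j. norm (u j)) summable_on UNIV"
      by (rule Infinite_Sum.abs_summable_on_comparison_test'[OF h]) (rule that)
    then have "u summable_on UNIV" by (rule abs_summable_summable)
    then have "(u has_sum infsum u UNIV) UNIV" by simp
    then have "((\<lambda>k. u (int_decode k)) has_sum infsum u UNIV) UNIV"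
      by (rule has_sum_reindex_bij_betw[OF bij, THEN iffD2])
    then show ?thesis by (rule sums_unique[OF has_sum_imp_sums])
  qed
  have "summable (\<lambda>k. h (int_decode k))"
    by (rule summable_on_imp_summable[OF summable_on_reindex_bij_betw[OF bij, THEN iffD2, OF h]])
  moreover have "eventually (\<lambda>(k, n). norm (f n (int_decode k)) \<le> h (int_decode k)) (sequentially \<times>\<^sub>F sequentially)"
    by (simp add: case_prod_unfold bound)
  ultimately have "(\<lambda>n. \<Sum>k. f n (int_decode k)) \<longlonglongrightarrow> (\<Sum>k. g (int_decode k))"
    using tannerys_theorem[of "\<lambda>k n. f n (int_decode k)" "\<lambda>k. g (int_decode k)" sequentially
        "\<lambda>k. h (int_decode k)", OF lim] by (metis sequentially_bot)
  moreover have "infsum (f n) UNIV = (\<Sum>k. f n (int_decode k))" for n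
    by (rule eq) (rule bound)
  moreover have "infsum g UNIV = (\<Sum>k. g (int_decode k))"
    by (rule eq) (rule gh)
  ultimately show ?thesis by (simp only:)
qed

section \<open>Gaussian binomial coefficients and their limits\<close>

context
  fixes Q :: "'a::{real_normed_field,banach}"
  assumes Q: "norm Q < 1"
begin

definition qfact :: "nat \<Rightarrow> 'a" where
  "qfact n = (\<Prod>k<n. 1 - Q * Q ^ k)"

text \<open>The Gaussian binomial coefficient; the \<open>(1 - Q)\<close> powers that normalize
  q-factorials cancel and are left out of \<open>qfact\<close>. The value 0 for \<open>i > n\<close>
  makes the Pascal rules hold at \<open>i = n\<close> too.\<close>

definition qbinom :: "nat \<Rightarrow> nat \<Rightarrow> 'a" where
  "qbinom n i = (if i \<le> n then qfact n / (qfact i * qfact (n - i)) else 0)"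

lemma one_minus_power_nonzero: "1 - Q ^ Suc k \<noteq> 0"
proof
  assume "1 - Q ^ Suc k = 0"
  then have "norm (Q ^ Suc k) = 1" by simp
  moreover have "norm (Q ^ Suc k) < 1"
    unfolding norm_power using Q by (subst power_less_one_iff) auto
  ultimately show False by simp
qed

lemma qfact_nonzero: "qfact n \<noteq> 0"
  using one_minus_power_nonzero by (simp add: qfact_def)

lemma qfact_0: "qfact 0 = 1" and qfact_Suc: "qfact (Suc n) = qfact n * (1 - Q ^ Suc n)"
  by (simp_all add: qfact_def)

lemma qbinom_0: "qbinom n 0 = 1" and qbinom_self: "qbinom n n = 1" and qbinom_Suc_self: "qbinom n (Suc n) = 0"
  by (simp_all add: qbinom_def qfact_0 qfact_nonzero)

text \<open>The two q-Pascal rules. For x = Q^(i+1) and y = Q^(n-i) they come from 1 - xy = (1-y) +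
  y(1-x) = (1-x) + x(1-y).\<close>

lemma qbinom_Suc_Suc:
  assumes "i \<le> n"
  shows "qbinom (Suc n) (Suc i) = qbinom n (Suc i) + Q ^ (n - i) * qbinom n i"
    and "qbinom (Suc n) (Suc i) = Q ^ Suc i * qbinom n (Suc i) + qbinom n i"
proof -
  have "qbinom (Suc n) (Suc i) = qbinom n (Suc i) + Q ^ (n - i) * qbinom n i \<and>
    qbinom (Suc n) (Suc i) = Q ^ Suc i * qbinom n (Suc i) + qbinom n i"
  proof (cases "i = n")
    case True
    then show ?thesis by (simp add: qbinom_self qbinom_Suc_self)
  next
    case False
    define m where "m = n - Suc i"
    have n: "n = Suc (i + m)" using False assms by (simp add: m_def)
    have nz: "1 - Q ^ Suc i \<noteq> 0" "1 - Q ^ Suc m \<noteq> 0"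
      by (rule one_minus_power_nonzero)+
    have f1: "qbinom (Suc n) (Suc i) = qfact n * (1 - Q ^ Suc n) / (qfact i * (1 - Q ^ Suc i) * (qfact m * (1 - Q ^ Suc m)))"
      using n by (simp add: qbinom_def qfact_Suc Suc_diff_le del: power_Suc)
    have f2: "qbinom n (Suc i) = qfact n / (qfact i * (1 - Q ^ Suc i) * qfact m)"
      using n by (simp add: qbinom_def qfact_Suc del: power_Suc)
    have f3: "qbinom n i = qfact n / (qfact i * (qfact m * (1 - Q ^ Suc m)))"
      using n by (simp add: qbinom_def qfact_Suc Suc_diff_le del: power_Suc)
    have f4: "Q ^ Suc n = Q ^ Suc i * Q ^ Suc m" "Q ^ (n - i) = Q ^ Suc m"
      using n by (simp_all add: power_add Suc_diff_le)
    have alg: "f * (1 - x * y) / (a * (1 - x) * (b * (1 - y))) =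
        f / (a * (1 - x) * b) + y * (f / (a * (b * (1 - y))))"
      "f * (1 - x * y) / (a * (1 - x) * (b * (1 - y))) =
        x * (f / (a * (1 - x) * b)) + f / (a * (b * (1 - y)))"
      if "1 - x \<noteq> 0" "1 - y \<noteq> 0" "a \<noteq> 0" "b \<noteq> 0" for f x y a b :: 'a
    proof -
      have *: "f * (A + B - A * B) / (a * A * (b * B)) = f / (a * A * b) + (1 - B) * (f / (a * (b * B)))"
        "f * (A + B - A * B) / (a * A * (b * B)) = (1 - A) * (f / (a * A * b)) + f / (a * (b * B))"
        if "A \<noteq> 0" "B \<noteq> 0" for A B
        using that \<open>a \<noteq> 0\<close> \<open>b \<noteq> 0\<close> by (simp_all add: divide_simps) (simp_all add: algebra_simps)
      have **: "1 - x * y = (1 - x) + (1 - y) - (1 - x) * (1 - y)" by (simp add: algebra_simps)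
      show "f * (1 - x * y) / (a * (1 - x) * (b * (1 - y))) =
          f / (a * (1 - x) * b) + y * (f / (a * (b * (1 - y))))"
        "f * (1 - x * y) / (a * (1 - x) * (b * (1 - y))) =
          x * (f / (a * (1 - x) * b)) + f / (a * (b * (1 - y)))"
        unfolding ** using *[OF that(1,2)] by simp_all
    qed
    show ?thesis
      unfolding f1 f2 f3 f4 by (intro conjI alg nz qfact_nonzero)
  qed
  then show "qbinom (Suc n) (Suc i) = qbinom n (Suc i) + Q ^ (n - i) * qbinom n i"
    and "qbinom (Suc n) (Suc i) = Q ^ Suc i * qbinom n (Suc i) + qbinom n i"
    by auto
qed

lemma qfact_LIMSEQ: "qfact \<longlonglongrightarrow> qpochhammer_inf Q Q"
  unfolding qfact_def[abs_def] by (rule qpochhammer_inf_LIMSEQ[OF Q])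

text \<open>\<open>qfact\<close> converges to a nonzero limit, so it and its inverse are bounded.
  The uniform bound supplies the dominating series for the triple product.\<close>

lemma qbinom_bounded: "\<exists>K. \<forall>n i. norm (qbinom n i) \<le> K"
proof -
  have "Bseq qfact" using qfact_LIMSEQ by (intro convergent_imp_Bseq convergentI)
  then obtain C where C: "C > 0" "\<And>n. norm (qfact n) \<le> C" unfolding Bseq_def by auto
  have "(\<lambda>n. inverse (qfact n)) \<longlonglongrightarrow> inverse (qpochhammer_inf Q Q)"
    by (intro tendsto_inverse qfact_LIMSEQ qpochhammer_inf_nonzero Q)
  then have "Bseq (\<lambda>n. inverse (qfact n))" by (intro convergent_imp_Bseq convergentI)
  then obtain D where D: "D > 0" "\<And>n. norm (inverse (qfact n)) \<le> D" unfolding Bseq_def by auto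
  have "norm (qbinom n i) \<le> C * (D * D)" for n i
  proof (cases "i \<le> n")
    case True
    then have "norm (qbinom n i) = norm (qfact n) * (norm (inverse (qfact i)) * norm (inverse (qfact (n - i))))"
      by (simp add: qbinom_def norm_divide norm_mult norm_inverse divide_simps)
    also have "\<dots> \<le> C * (D * D)"
      using C D by (intro mult_mono) (auto intro: less_imp_le)
    finally show ?thesis .
  next
    case False
    then show ?thesis using C(1) D(1) by (simp add: qbinom_def)
  qed
  then show ?thesis by blast
qed

lemma qbinom_central_LIMSEQ:
  "(\<lambda>N. qbinom (2 * N) (nat (int N + j))) \<longlonglongrightarrow> 1 / qpochhammer_inf Q Q"
proof (rule Lim_transform_eventually)
  let ?E = "qpochhammer_inf Q Q"
  have ev: "filterlim g sequentially sequentially" if "\<And>N. int N \<le> int (g N) + \<bar>j\<bar>" for g :: "nat \<Rightarrow> nat"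
    unfolding filterlim_at_top
  proof
    fix Z
    show "eventually (\<lambda>N. Z \<le> g N) sequentially"
      using eventually_ge_at_top[of "Z + nat \<bar>j\<bar>"]
    proof eventually_elim
      case (elim N)
      with that[of N] show ?case by linarith
    qed
  qed
  have "filterlim (\<lambda>N. 2 * N) sequentially sequentially"
    and "filterlim (\<lambda>N. nat (int N + j)) sequentially sequentially"
    and "filterlim (\<lambda>N. nat (int N - j)) sequentially sequentially"
    by (rule ev; linarith)+
  then have "(\<lambda>N. qfact (2 * N) / (qfact (nat (int N + j)) * qfact (nat (int N - j)))) \<longlonglongrightarrow> ?E / (?E * ?E)"
    by (intro tendsto_intros filterlim_compose[OF qfact_LIMSEQ])
      (simp_all add: qpochhammer_inf_nonzero Q)
  then show "(\<lambda>N. qfact (2 * N) / (qfact (nat (int N + j)) * qfact (nat (int N - j)))) \<longlonglongrightarrow> 1 / ?E"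
    by (simp add: qpochhammer_inf_nonzero Q)
  show "eventually (\<lambda>N. qfact (2 * N) / (qfact (nat (int N + j)) * qfact (nat (int N - j))) =
    qbinom (2 * N) (nat (int N + j))) sequentially"
    using eventually_ge_at_top[of "nat \<bar>j\<bar>"]
  proof eventually_elim
    case (elim N)
    then have "nat (int N + j) \<le> 2 * N" "2 * N - nat (int N + j) = nat (int N - j)" by linarith+
    then show ?case by (simp add: qbinom_def)
  qed
qed

end

subsection \<open>Jacobi's triple product\<close>

text \<open>The common induction step for the finite product: one more linear factor turns the
  coefficients \<open>c\<close> into \<open>d\<close> by a Pascal-type recurrence.\<close>

lemma linear_factor_mult_sum:
  fixes c d :: "nat \<Rightarrow> 'a::comm_ring_1"
  assumes "c (Suc n) = 0" "d 0 = a * c 0" "\<And>i. i \<le> n \<Longrightarrow> d (Suc i) = a * c (Suc i) + b * c i"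
  shows "(a + b * z) * (\<Sum>i\<le>n. c i * z ^ i) = (\<Sum>i\<le>Suc n. d i * z ^ i)"
proof -
  have "(\<Sum>i\<le>Suc n. d i * z ^ i) = d 0 + (\<Sum>i\<le>n. d (Suc i) * z ^ Suc i)"
    by (subst sum.atMost_Suc_shift) simp
  also have "\<dots> = a * (c 0 + (\<Sum>i\<le>n. c (Suc i) * z ^ Suc i)) + b * z * (\<Sum>i\<le>n. c i * z ^ i)"
    using assms(2,3) by (simp add: algebra_simps sum.distrib sum_distrib_left)
  also have "c 0 + (\<Sum>i\<le>n. c (Suc i) * z ^ Suc i) = (\<Sum>i\<le>Suc n. c i * z ^ i)"
    by (subst sum.atMost_Suc_shift) simp
  also have "\<dots> = (\<Sum>i\<le>n. c i * z ^ i)"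
    using assms(1) by simp
  finally show ?thesis by (simp add: algebra_simps)
qed

context
  fixes q :: "'a::{real_normed_field,banach}"
  assumes q: "q \<noteq> 0" "norm q < 1"
begin

lemma norm_q_square: "norm (q\<^sup>2) < 1"
  using q by (simp add: norm_power power_less_one_iff)

lemma q_power_int_mult: "q ^ k * q powi l = q powi (int k + l)"
  using q by (simp add: power_int_add)

text \<open>Independent bounds \<open>M\<close> and \<open>N\<close> allow adding one factor at a
  time. A factor \<open>z + q ^ (2 * N + 1)\<close> uses the second q-Pascal rule, a factor
  \<open>1 + z * q ^ (2 * M + 1)\<close> the first.\<close>

lemma finite_triple_product:
  "(\<Prod>k<M. 1 + z * q ^ (2 * k + 1)) * (\<Prod>k<N. z + q ^ (2 * k + 1)) =
    (\<Sum>i\<le>M + N. q powi ((int i - int N)\<^sup>2) * qbinom (q\<^sup>2) (M + N) i * z ^ i)"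
proof (induction M)
  case 0
  show ?case
  proof (induction N)
    case 0
    show ?case by (simp add: qbinom_0[OF norm_q_square])
  next
    case (Suc N)
    let ?c = "\<lambda>i. q powi ((int i - int N)\<^sup>2) * qbinom (q\<^sup>2) N i"
    let ?d = "\<lambda>i. q powi ((int i - int (Suc N))\<^sup>2) * qbinom (q\<^sup>2) (Suc N) i"
    have "(q ^ (2 * N + 1) + 1 * z) * (\<Sum>i\<le>N. ?c i * z ^ i) = (\<Sum>i\<le>Suc N. ?d i * z ^ i)"
    proof (rule linear_factor_mult_sum)
      show "?c (Suc N) = 0" by (simp add: qbinom_Suc_self[OF norm_q_square])
      have "int (2 * N + 1) + (int 0 - int N)\<^sup>2 = (int 0 - int (Suc N))\<^sup>2"
        by (simp add: power2_eq_square algebra_simps)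
      then show "?d 0 = q ^ (2 * N + 1) * ?c 0"
        by (simp only: mult.assoc[symmetric] q_power_int_mult qbinom_0[OF norm_q_square])
      fix i assume "i \<le> N"
      have "q ^ (2 * N + 1) * q powi ((int (Suc i) - int N)\<^sup>2) =
          q powi ((int (Suc i) - int (Suc N))\<^sup>2) * (q\<^sup>2) ^ Suc i"
        unfolding power_mult[symmetric] mult.commute[of "q powi _"] q_power_int_mult
        by (rule arg_cong[of _ _ "power_int q"]) (simp add: power2_eq_square algebra_simps)
      then show "?d (Suc i) = q ^ (2 * N + 1) * ?c (Suc i) + 1 * ?c i"
        using qbinom_Suc_Suc(2)[OF norm_q_square \<open>i \<le> N\<close>]
        by (simp add: algebra_simps)
    qed
    then show ?case using Suc.IH by (simp add: algebra_simps)
  qed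
next
  case (Suc M)
  let ?c = "\<lambda>i. q powi ((int i - int N)\<^sup>2) * qbinom (q\<^sup>2) (M + N) i"
  let ?d = "\<lambda>i. q powi ((int i - int N)\<^sup>2) * qbinom (q\<^sup>2) (Suc (M + N)) i"
  have "(1 + q ^ (2 * M + 1) * z) * (\<Sum>i\<le>M + N. ?c i * z ^ i) = (\<Sum>i\<le>Suc (M + N). ?d i * z ^ i)"
  proof (rule linear_factor_mult_sum)
    show "?c (Suc (M + N)) = 0" by (simp add: qbinom_Suc_self[OF norm_q_square])
    show "?d 0 = 1 * ?c 0" by (simp add: qbinom_0[OF norm_q_square])
    fix i assume i: "i \<le> M + N"
    have "q ^ (2 * M + 1) * q powi ((int i - int N)\<^sup>2) =
        q powi ((int (Suc i) - int N)\<^sup>2) * (q\<^sup>2) ^ (M + N - i)"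
      unfolding power_mult[symmetric] mult.commute[of "q powi _"] q_power_int_mult
      using i by (intro arg_cong[of _ _ "power_int q"]) (simp add: of_nat_diff power2_eq_square algebra_simps)
    then show "?d (Suc i) = 1 * ?c (Suc i) + q ^ (2 * M + 1) * ?c i"
      using qbinom_Suc_Suc(1)[OF norm_q_square i]
      by (simp add: algebra_simps)
  qed
  then show ?case using Suc.IH by (simp add: algebra_simps)
qed

text \<open>Dividing by \<open>z ^ N\<close> and setting i = N + j centres the sum; extending it by
  0 to all integers prepares it for dominated convergence.\<close>

lemma finite_jacobi_triple_product:
  assumes z: "z \<noteq> 0"
  shows "(\<Prod>k<N. 1 + z * q ^ (2 * k + 1)) * (\<Prod>k<N. 1 + q ^ (2 * k + 1) / z) =
    (\<Sum>\<^sub>\<infinity>j. if \<bar>j\<bar> \<le> int N then q powi (j\<^sup>2) * z powi j * qbinom (q\<^sup>2) (2 * N) (nat (int N + j)) else 0)"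
    (is "_ = infsum ?f UNIV")
proof -
  have "(\<Prod>k<N. 1 + q ^ (2 * k + 1) / z) = (\<Prod>k<N. (z + q ^ (2 * k + 1)) / z)"
    using z by (intro prod.cong) (simp_all add: add_divide_distrib)
  also have "\<dots> = (\<Prod>k<N. z + q ^ (2 * k + 1)) / z ^ N"
    by (simp add: prod_dividef)
  finally have "(\<Prod>k<N. 1 + z * q ^ (2 * k + 1)) * (\<Prod>k<N. 1 + q ^ (2 * k + 1) / z) =
      (\<Sum>i\<le>N + N. q powi ((int i - int N)\<^sup>2) * qbinom (q\<^sup>2) (N + N) i * z ^ i) / z ^ N"
    using finite_triple_product[of z N N] by simp
  also have "\<dots> = (\<Sum>i\<le>2 * N. ?f (int i - int N))"
    unfolding sum_divide_distrib mult_2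
  proof (rule sum.cong[OF refl])
    fix i assume "i \<in> {..N + N}"
    moreover have "z powi (int i - int N) = z ^ i / z ^ N"
      using z by (simp add: power_int_diff)
    ultimately show "q powi ((int i - int N)\<^sup>2) * qbinom (q\<^sup>2) (N + N) i * z ^ i / z ^ N =
      (if \<bar>int i - int N\<bar> \<le> int N then q powi ((int i - int N)\<^sup>2) * z powi (int i - int N) *
        qbinom (q\<^sup>2) (N + N) (nat (int N + (int i - int N))) else 0)"
      by simp
  qed
  also have "\<dots> = sum ?f {- int N..int N}"
    by (rule sum.reindex_bij_witness[of _ "\<lambda>j. nat (int N + j)" "\<lambda>i. int i - int N"]) auto
  also have "\<dots> = infsum ?f {- int N..int N}"
    by simp
  also have "\<dots> = infsum ?f UNIV"
    by (rule infsum_cong_neutral) auto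
  finally show ?thesis .
qed

text \<open>Let \<open>N\<close> tend to infinity in the finite identity: each central Gaussian
  binomial tends to \<open>1 / ?E\<close>, and a multiple of the absolute theta series
  dominates.\<close>

lemma jacobi_triple_product:
  assumes z: "z \<noteq> 0"
  shows "theta_sum q z = qpochhammer_inf (q\<^sup>2) (q\<^sup>2) *
    (qpochhammer_inf (- (z * q)) (q\<^sup>2) * qpochhammer_inf (- (q / z)) (q\<^sup>2))"
proof -
  let ?E = "qpochhammer_inf (q\<^sup>2) (q\<^sup>2)"
  let ?f = "\<lambda>N j. if \<bar>j\<bar> \<le> int N then q powi (j\<^sup>2) * z powi j * qbinom (q\<^sup>2) (2 * N) (nat (int N + j)) else 0"
  obtain K where K: "\<And>n i. norm (qbinom (q\<^sup>2) n i) \<le> K"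
    using qbinom_bounded[OF norm_q_square] by auto
  have K0: "0 \<le> K" using K[of 0 0] norm_ge_zero order_trans by blast
  have "(\<lambda>N. infsum (?f N) UNIV) \<longlonglongrightarrow> (\<Sum>\<^sub>\<infinity>j. q powi (j\<^sup>2) * z powi j * (1 / ?E))"
  proof (rule tendsto_infsum_dominated)
    fix j
    have "(\<lambda>N. q powi (j\<^sup>2) * z powi j * qbinom (q\<^sup>2) (2 * N) (nat (int N + j))) \<longlonglongrightarrow> q powi (j\<^sup>2) * z powi j * (1 / ?E)"
      by (intro tendsto_mult_left qbinom_central_LIMSEQ[OF norm_q_square])
    moreover have "eventually (\<lambda>N. q powi (j\<^sup>2) * z powi j * qbinom (q\<^sup>2) (2 * N) (nat (int N + j)) = ?f N j) sequentially"
      using eventually_ge_at_top[of "nat \<bar>j\<bar>"] by eventually_elim simp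
    ultimately show "(\<lambda>N. ?f N j) \<longlonglongrightarrow> q powi (j\<^sup>2) * z powi j * (1 / ?E)"
      by (rule Lim_transform_eventually)
    show "norm (?f N j) \<le> norm (q powi (j\<^sup>2) * z powi j) * K" for N
      using K K0 by (auto simp: norm_mult intro!: mult_left_mono)
  next
    show "(\<lambda>j. norm (q powi (j\<^sup>2) * z powi j) * K) summable_on UNIV"
      by (intro summable_on_cmult_left abs_summable_theta q z)
  qed
  moreover have "(\<lambda>N. infsum (?f N) UNIV) \<longlonglongrightarrow> qpochhammer_inf (- (z * q)) (q\<^sup>2) * qpochhammer_inf (- (q / z)) (q\<^sup>2)"
    unfolding finite_jacobi_triple_product[OF z, symmetric]
    using tendsto_mult[OF qpochhammer_inf_LIMSEQ[OF norm_q_square, of "- (z * q)"] qpochhammer_inf_LIMSEQ[OF norm_q_square, of "- (q / z)"]]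
    by (simp add: power_mult mult.assoc)
  ultimately have "(\<Sum>\<^sub>\<infinity>j. q powi (j\<^sup>2) * z powi j * (1 / ?E)) =
      qpochhammer_inf (- (z * q)) (q\<^sup>2) * qpochhammer_inf (- (q / z)) (q\<^sup>2)"
    by (rule LIMSEQ_unique)
  then have "theta_sum q z * (1 / ?E) = qpochhammer_inf (- (z * q)) (q\<^sup>2) * qpochhammer_inf (- (q / z)) (q\<^sup>2)"
    by (simp only: infsum_cmult_left' theta_sum_def)
  moreover have "?E \<noteq> 0" by (intro qpochhammer_inf_nonzero norm_q_square)
  ultimately show ?thesis by (simp add: field_simps)
qed

end

subsection \<open>Product formulas and the cubic multiplication formula\<close>

lemma qpochhammer_inf_head:
  fixes a q :: "'a::{real_normed_field,banach}"
  assumes q: "norm q < 1"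
  shows "qpochhammer_inf a q = (1 - a) * qpochhammer_inf (a * q) q"
proof (rule LIMSEQ_unique)
  show "(\<lambda>n. \<Prod>k<Suc n. 1 - a * q ^ k) \<longlonglongrightarrow> qpochhammer_inf a q"
    by (rule LIMSEQ_Suc[OF qpochhammer_inf_LIMSEQ[OF q]])
  have "(\<Prod>k<Suc n. 1 - a * q ^ k) = (1 - a) * (\<Prod>k<n. 1 - a * q * q ^ k)" for n
    by (subst prod.lessThan_Suc_shift) (simp add: mult.assoc)
  then show "(\<lambda>n. \<Prod>k<Suc n. 1 - a * q ^ k) \<longlonglongrightarrow> (1 - a) * qpochhammer_inf (a * q) q"
    using tendsto_mult_left[OF qpochhammer_inf_LIMSEQ[OF q, of "a * q"], of "1 - a"] by simp
qed

lemma qpochhammer_inf_split_2: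
  fixes a q :: "'a::{real_normed_field,banach}"
  assumes "norm q < 1"
  shows "qpochhammer_inf a q = qpochhammer_inf a (q\<^sup>2) * qpochhammer_inf (a * q) (q\<^sup>2)"
  using qpochhammer_inf_split[OF assms, of 2 a] by (simp add: numeral_2_eq_2)

lemma qpochhammer_inf_split_3:
  fixes a q :: "'a::{real_normed_field,banach}"
  assumes "norm q < 1"
  shows "qpochhammer_inf a q =
    qpochhammer_inf a (q ^ 3) * qpochhammer_inf (a * q) (q ^ 3) * qpochhammer_inf (a * q\<^sup>2) (q ^ 3)"
  using qpochhammer_inf_split[OF assms, of 3 a]
  by (simp add: eval_nat_numeral mult.assoc)

lemma cube_root_of_unity:
  fixes \<omega> :: "'a::comm_ring_1"
  assumes "\<omega>\<^sup>2 + \<omega> + 1 = 0"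
  shows "\<omega> ^ 3 = 1"
proof -
  have "\<omega> ^ 3 - 1 = (\<omega> - 1) * (\<omega>\<^sup>2 + \<omega> + 1)" by (simp add: power2_eq_square power3_eq_cube algebra_simps)
  then show ?thesis using assms by simp
qed

lemma norm_cube_root_of_unity:
  fixes \<omega> :: "'a::real_normed_field"
  assumes "\<omega>\<^sup>2 + \<omega> + 1 = 0"
  shows "norm \<omega> = 1"
  using cube_root_of_unity[OF assms] by (metis norm_one norm_power norm_ge_zero power_eq_1_iff zero_neq_numeral)

text \<open>Factor by factor this is (1-x)(1-\<omega>x)(1-\<omega>^2 x) = 1 - x^3.\<close>

lemma qpochhammer_inf_cube_roots:
  fixes a q \<omega> :: "'a::{real_normed_field,banach}"
  assumes q: "norm q < 1" and \<omega>: "\<omega>\<^sup>2 + \<omega> + 1 = 0"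
  shows "qpochhammer_inf a q * qpochhammer_inf (\<omega> * a) q * qpochhammer_inf (\<omega>\<^sup>2 * a) q =
    qpochhammer_inf (a ^ 3) (q ^ 3)"
proof (rule LIMSEQ_unique)
  have q3: "norm (q ^ 3) < 1" using q by (simp add: norm_power power_less_one_iff)
  show "(\<lambda>n. \<Prod>k<n. 1 - a ^ 3 * (q ^ 3) ^ k) \<longlonglongrightarrow> qpochhammer_inf (a ^ 3) (q ^ 3)"
    by (rule qpochhammer_inf_LIMSEQ[OF q3])
  have *: "(1 - x) * (1 - \<omega> * x) * (1 - \<omega>\<^sup>2 * x) = 1 - x ^ 3" for x :: 'a
  proof -
    have w2: "\<omega>\<^sup>2 = - 1 - \<omega>" using \<omega> by (simp add: algebra_simps eq_neg_iff_add_eq_0)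
    have w2': "\<omega> * \<omega> = - 1 - \<omega>" "\<omega> * (\<omega> * y) = (- 1 - \<omega>) * y" for y
      using w2 by (simp_all add: power2_eq_square flip: mult.assoc)
    show ?thesis unfolding w2 by (simp add: algebra_simps w2' power3_eq_cube)
  qed
  have "(\<Prod>k<n. 1 - a ^ 3 * (q ^ 3) ^ k) =
    (\<Prod>k<n. 1 - a * q ^ k) * (\<Prod>k<n. 1 - \<omega> * a * q ^ k) * (\<Prod>k<n. 1 - \<omega>\<^sup>2 * a * q ^ k)" for n
    unfolding prod.distrib[symmetric]
  proof (rule prod.cong[OF refl])
    fix k
    show "1 - a ^ 3 * (q ^ 3) ^ k = (1 - a * q ^ k) * (1 - \<omega> * a * q ^ k) * (1 - \<omega>\<^sup>2 * a * q ^ k)"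
      using *[of "a * q ^ k"] by (simp add: power_mult_distrib mult_ac flip: power_mult)
  qed
  then show "(\<lambda>n. \<Prod>k<n. 1 - a ^ 3 * (q ^ 3) ^ k) \<longlonglongrightarrow>
    qpochhammer_inf a q * qpochhammer_inf (\<omega> * a) q * qpochhammer_inf (\<omega>\<^sup>2 * a) q"
    by (simp only:) (intro tendsto_mult qpochhammer_inf_LIMSEQ q)
qed

lemma theta_phi_of_real:
  assumes "\<bar>q\<bar> < 1"
  shows "theta_phi (of_real q) = (of_real (theta_phi q) :: 'a::{real_normed_field,banach})"
proof -
  have "((\<lambda>n::int. q powi (n\<^sup>2)) has_sum theta_phi q) UNIV"
    using has_sum_theta[of q 1] assms by (simp add: theta_phi_eq_theta_sum)
  from has_sum_of_real[OF this, where 'a = 'a]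
  show ?thesis unfolding theta_phi_def[of "of_real q"] by (intro infsumI) simp
qed

lemma ramanujan_chi_of_real:
  assumes "\<bar>q\<bar> < 1"
  shows "ramanujan_chi (of_real q) = (of_real (ramanujan_chi q) :: 'a::{real_normed_field,banach})"
  using qpochhammer_inf_of_real[of "q\<^sup>2" "- q", where 'a = 'a] assms
  by (simp add: ramanujan_chi_def abs_square_less_1)

context
  fixes q :: "'a::{real_normed_field,banach}"
  assumes q: "q \<noteq> 0" "norm q < 1"
begin

lemma theta_phi_product: "theta_phi q = qpochhammer_inf (q\<^sup>2) (q\<^sup>2) * (ramanujan_chi q)\<^sup>2"
  using jacobi_triple_product[OF q, of 1]
  by (simp add: theta_phi_eq_theta_sum ramanujan_chi_def power2_eq_square)

text \<open>In the triple product at z = q one of the products has parameter -1; its first factor is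
  the 2, and what remains equals the other product.\<close>

lemma theta_psi2_product:
  "theta_psi2 q = 2 * qpochhammer_inf (q\<^sup>2) (q\<^sup>2) * (qpochhammer_inf (- (q\<^sup>2)) (q\<^sup>2))\<^sup>2"
  using jacobi_triple_product[OF q, of q] qpochhammer_inf_head[OF norm_q_square[OF q], of "- 1"] q
  by (simp add: power2_eq_square)

text \<open>Euler's argument: factor (q^2;q^2) as (q;q)(-q;q), separate odd and even exponents in
  both, and cancel (q^2;q^2).\<close>

lemma ramanujan_chi_mult:
  "ramanujan_chi q * ramanujan_chi (- q) * qpochhammer_inf (- (q\<^sup>2)) (q\<^sup>2) = 1"
proof -
  have "qpochhammer_inf (q\<^sup>2) (q\<^sup>2) = qpochhammer_inf q q * qpochhammer_inf (- q) q"
    by (simp add: qpochhammer_inf_mult_minus q)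
  also have "\<dots> = qpochhammer_inf q (q\<^sup>2) * qpochhammer_inf (q\<^sup>2) (q\<^sup>2) *
      (qpochhammer_inf (- q) (q\<^sup>2) * qpochhammer_inf (- (q\<^sup>2)) (q\<^sup>2))"
    using qpochhammer_inf_split_2[of q q] qpochhammer_inf_split_2[of q "- q"] q
    by (simp add: power2_eq_square)
  finally show ?thesis
    using qpochhammer_inf_nonzero[OF norm_q_square norm_q_square, OF q q]
    by (simp add: ramanujan_chi_def mult_ac)
qed

lemma ramanujan_chi_power_6:
  "ramanujan_chi q ^ 6 * theta_psi2 q * theta_phi (- q) = 2 * (theta_phi q)\<^sup>2"
proof -
  have "theta_phi (- q) = qpochhammer_inf (q\<^sup>2) (q\<^sup>2) * (ramanujan_chi (- q))\<^sup>2"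
    using jacobi_triple_product[of "- q" 1] q
    by (simp add: theta_phi_eq_theta_sum ramanujan_chi_def power2_eq_square)
  then have "ramanujan_chi q ^ 6 * theta_psi2 q * theta_phi (- q) =
      2 * (qpochhammer_inf (q\<^sup>2) (q\<^sup>2) * (ramanujan_chi q)\<^sup>2)\<^sup>2 *
      (ramanujan_chi q * ramanujan_chi (- q) * qpochhammer_inf (- (q\<^sup>2)) (q\<^sup>2))\<^sup>2"
    by (simp add: theta_psi2_product power_mult_distrib eval_nat_numeral mult_ac)
  then show ?thesis by (simp add: ramanujan_chi_mult theta_phi_product)
qed

text \<open>The sum is split by n modulo 3; the classes 3n+1 and 3n-1 contribute equally under n ->
  -n.\<close>

lemma theta_phi_trisection:
  "theta_phi q = theta_phi (q ^ 9) + 2 * q * theta_sum (q ^ 9) (q ^ 6)"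
proof -
  let ?f = "\<lambda>n::int. q powi (n\<^sup>2)"
  let ?F = "theta_sum (q ^ 9) (q ^ 6)"
  have q9: "norm (q ^ 9) < 1" using q by (simp add: norm_power power_less_one_iff)
  have F: "((\<lambda>n. q powi (9 * n\<^sup>2 + 6 * n)) has_sum ?F) UNIV"
    using has_sum_theta[OF q9, of "q ^ 6"] q by (simp add: power_int_power_left power_int_add)
  have "bij_betw uminus (UNIV :: int set) UNIV"
    by (rule bij_betw_byWitness[where f' = uminus]) auto
  from has_sum_reindex_bij_betw[OF this, THEN iffD2, OF F]
  have F': "((\<lambda>n. q powi (9 * n\<^sup>2 - 6 * n)) has_sum ?F) UNIV" by simp
  have 0: "(?f has_sum theta_phi (q ^ 9)) (range (\<lambda>n. 3 * n))"
    using has_sum_theta[OF q9, of 1]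
    by (subst has_sum_reindex) (auto simp: inj_def o_def theta_phi_eq_theta_sum power_int_power_left power_mult_distrib)
  have 1: "(?f has_sum (q * ?F)) (range (\<lambda>n. 3 * n + 1))"
    by (subst has_sum_reindex)
      (auto simp: inj_def o_def power2_eq_square algebra_simps q intro!: has_sum_power_int_shift[OF F])
  have 2: "(?f has_sum (q * ?F)) (range (\<lambda>n. 3 * n - 1))"
    by (subst has_sum_reindex)
      (auto simp: inj_def o_def power2_eq_square algebra_simps q intro!: has_sum_power_int_shift[OF F'])
  have "(?f has_sum (theta_phi (q ^ 9) + q * ?F + q * ?F))
      (range (\<lambda>n. 3 * n) \<union> range (\<lambda>n. 3 * n + 1) \<union> range (\<lambda>n. 3 * n - 1))"
    by (intro has_sum_Un_disjoint 0 1 2) (auto; presburger)+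
  moreover have "range (\<lambda>n::int. 3 * n) \<union> range (\<lambda>n. 3 * n + 1) \<union> range (\<lambda>n. 3 * n - 1) = UNIV"
    by (auto simp: image_iff) presburger
  ultimately have "(?f has_sum (theta_phi (q ^ 9) + q * ?F + q * ?F)) UNIV" by simp
  then show ?thesis unfolding theta_phi_def[of q] by (subst infsumI) (auto simp: algebra_simps)
qed

text \<open>The triple product contributes the factors 1 + q^k with k congruent to 1 or 5 modulo 6.
  These are the factors of \<chi>(q) except those with 3 dividing k, which form \<chi>(q^3).\<close>

lemma theta_sum_cubic_product:
  "theta_sum (q ^ 3) (q\<^sup>2) * ramanujan_chi (q ^ 3) = qpochhammer_inf (q ^ 6) (q ^ 6) * ramanujan_chi q"
proof -
  have q3: "q ^ 3 \<noteq> 0" "norm (q ^ 3) < 1" using q by (simp_all add: norm_power power_less_one_iff)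
  have "theta_sum (q ^ 3) (q\<^sup>2) = qpochhammer_inf (q ^ 6) (q ^ 6) *
      (qpochhammer_inf (- (q ^ 5)) (q ^ 6) * qpochhammer_inf (- q) (q ^ 6))"
    using jacobi_triple_product[OF q3, of "q\<^sup>2"] q
    by (simp add: eval_nat_numeral mult.assoc)
  moreover have "ramanujan_chi q = qpochhammer_inf (- q) (q ^ 6) * qpochhammer_inf (- (q ^ 3)) (q ^ 6) * qpochhammer_inf (- (q ^ 5)) (q ^ 6)"
    unfolding ramanujan_chi_def using qpochhammer_inf_split_3[OF norm_q_square[OF q], of "- q"]
    by (simp add: power_mult[symmetric] power_add[symmetric] flip: power_Suc)
  ultimately show ?thesis
    by (simp add: ramanujan_chi_def mult_ac flip: power_mult)
qed

lemma cube_root_multiples: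
  assumes \<omega>: "\<omega>\<^sup>2 + \<omega> + 1 = 0"
  shows "(\<omega> * q) ^ 3 = q ^ 3" "(\<omega>\<^sup>2 * q) ^ 3 = q ^ 3" "norm (\<omega> * q) < 1" "norm (\<omega>\<^sup>2 * q) < 1"
  using cube_root_of_unity[OF \<omega>] norm_cube_root_of_unity[OF \<omega>] q power_mult[of \<omega> 3 2]
  by (simp_all add: power_mult_distrib norm_mult norm_power mult.commute flip: power_mult)

text \<open>Exponents divisible by 3 give (q^3;q^3) once for each cube root; the others combine over
  the three roots to the part of (q^3;q^3) that (q^9;q^9) completes.\<close>

lemma euler_function_cubic:
  assumes \<omega>: "\<omega>\<^sup>2 + \<omega> + 1 = 0"
  shows "qpochhammer_inf q q * qpochhammer_inf (\<omega> * q) (\<omega> * q) * qpochhammer_inf (\<omega>\<^sup>2 * q) (\<omega>\<^sup>2 * q) *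
    qpochhammer_inf (q ^ 9) (q ^ 9) = qpochhammer_inf (q ^ 3) (q ^ 3) ^ 4"
proof -
  note [simp] = cube_root_of_unity[OF \<omega>] norm_cube_root_of_unity[OF \<omega>]
  have q3: "norm (q ^ 3) < 1" using q by (simp add: norm_power power_less_one_iff)
  let ?e = "qpochhammer_inf (q ^ 3) (q ^ 3)"
  have split: "qpochhammer_inf w w = qpochhammer_inf w (q ^ 3) * qpochhammer_inf (w\<^sup>2) (q ^ 3) * ?e"
    if "w ^ 3 = q ^ 3" "norm w < 1" for w
    using qpochhammer_inf_split_3[of w w] that
    by (simp add: power2_eq_square power3_eq_cube mult.assoc)
  have e: "?e = qpochhammer_inf (q ^ 3) (q ^ 9) * qpochhammer_inf (q ^ 6) (q ^ 9) * qpochhammer_inf (q ^ 9) (q ^ 9)"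
    using qpochhammer_inf_split_3[OF q3, of "q ^ 3"] by (simp flip: power_mult power_add)
  have r: "qpochhammer_inf q (q ^ 3) * qpochhammer_inf (\<omega> * q) (q ^ 3) * qpochhammer_inf (\<omega>\<^sup>2 * q) (q ^ 3) =
      qpochhammer_inf (q ^ 3) (q ^ 9)"
    using qpochhammer_inf_cube_roots[OF q3 \<omega>, of q] by (simp flip: power_mult)
  have r2: "qpochhammer_inf (q\<^sup>2) (q ^ 3) * qpochhammer_inf ((\<omega> * q)\<^sup>2) (q ^ 3) * qpochhammer_inf ((\<omega>\<^sup>2 * q)\<^sup>2) (q ^ 3) =
      qpochhammer_inf (q ^ 6) (q ^ 9)"
  proof -
    have "\<omega> ^ 4 = \<omega>"
      using power_add[of \<omega> 3 1] by simp
    then have *: "(\<omega>\<^sup>2 * q)\<^sup>2 = \<omega> * q\<^sup>2"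
      by (simp add: power_mult_distrib flip: power_mult)
    show ?thesis
      unfolding * using qpochhammer_inf_cube_roots[OF q3 \<omega>, of "q\<^sup>2"]
      by (simp add: power_mult_distrib mult_ac flip: power_mult)
  qed
  have "qpochhammer_inf q q * qpochhammer_inf (\<omega> * q) (\<omega> * q) * qpochhammer_inf (\<omega>\<^sup>2 * q) (\<omega>\<^sup>2 * q) =
    (qpochhammer_inf q (q ^ 3) * qpochhammer_inf (\<omega> * q) (q ^ 3) * qpochhammer_inf (\<omega>\<^sup>2 * q) (q ^ 3)) *
    (qpochhammer_inf (q\<^sup>2) (q ^ 3) * qpochhammer_inf ((\<omega> * q)\<^sup>2) (q ^ 3) * qpochhammer_inf ((\<omega>\<^sup>2 * q)\<^sup>2) (q ^ 3)) * ?e ^ 3"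
    unfolding split[OF refl q(2)] split[OF cube_root_multiples(1,3)[OF \<omega>]] split[OF cube_root_multiples(2,4)[OF \<omega>]]
    by (simp add: power3_eq_cube mult_ac)
  then show ?thesis
    unfolding r r2 using e by (simp add: eval_nat_numeral mult_ac)
qed

text \<open>The same sorting of factors, now over odd exponents modulo 6: class 3 is unaffected by
  \<omega>, and classes 1 and 5 combine over the three roots.\<close>

lemma ramanujan_chi_cubic:
  assumes \<omega>: "\<omega>\<^sup>2 + \<omega> + 1 = 0"
  shows "ramanujan_chi q * ramanujan_chi (\<omega> * q) * ramanujan_chi (\<omega>\<^sup>2 * q) * ramanujan_chi (q ^ 9) =
    ramanujan_chi (q ^ 3) ^ 4"
proof -
  note [simp] = cube_root_of_unity[OF \<omega>] norm_cube_root_of_unity[OF \<omega>]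
  let ?Q = "q ^ 6"
  have q6: "norm ?Q < 1" using q by (simp add: norm_power power_less_one_iff)
  let ?x = "ramanujan_chi (q ^ 3)"
  have split: "ramanujan_chi w = qpochhammer_inf (- w) ?Q * ?x * qpochhammer_inf (- (w ^ 5)) ?Q"
    if "w ^ 3 = q ^ 3" "norm w < 1" for w
  proof -
    have "w ^ 6 = (w ^ 3) ^ 2" by (simp flip: power_mult)
    also have "\<dots> = q ^ 6" by (simp add: that(1) flip: power_mult)
    finally have "w ^ 6 = q ^ 6" .
    moreover have "norm (w\<^sup>2) < 1" using that by (simp add: norm_power power_less_one_iff)
    ultimately show ?thesis
      unfolding ramanujan_chi_def using qpochhammer_inf_split_3[of "w\<^sup>2" "- w"] that(1)
      by (simp add: power_mult[symmetric] power_add[symmetric] flip: power_Suc)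
  qed
  have e: "?x = qpochhammer_inf (- (q ^ 3)) (q ^ 18) * ramanujan_chi (q ^ 9) * qpochhammer_inf (- (q ^ 15)) (q ^ 18)"
    unfolding ramanujan_chi_def
    using qpochhammer_inf_split_3[of "q ^ 6" "- (q ^ 3)"] q6 by (simp flip: power_mult power_add)
  have r: "qpochhammer_inf (- q) ?Q * qpochhammer_inf (- (\<omega> * q)) ?Q * qpochhammer_inf (- (\<omega>\<^sup>2 * q)) ?Q =
      qpochhammer_inf (- (q ^ 3)) (q ^ 18)"
    using qpochhammer_inf_cube_roots[OF q6 \<omega>, of "- q"] by (simp flip: power_mult)
  have r5: "qpochhammer_inf (- (q ^ 5)) ?Q * qpochhammer_inf (- ((\<omega> * q) ^ 5)) ?Q * qpochhammer_inf (- ((\<omega>\<^sup>2 * q) ^ 5)) ?Q =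
      qpochhammer_inf (- (q ^ 15)) (q ^ 18)"
  proof -
    have "\<omega> ^ 5 = \<omega>\<^sup>2" "\<omega> ^ 10 = \<omega>"
      using power_add[of \<omega> 3 2] power_add[of \<omega> 9 1] power_mult[of \<omega> 3 3] by simp_all
    then have "(\<omega> * q) ^ 5 = \<omega>\<^sup>2 * q ^ 5" "(\<omega>\<^sup>2 * q) ^ 5 = \<omega> * q ^ 5"
      by (simp_all add: power_mult_distrib flip: power_mult)
    then show ?thesis
      using qpochhammer_inf_cube_roots[OF q6 \<omega>, of "- (q ^ 5)"]
      by (simp add: mult_ac flip: power_mult)
  qed
  have "ramanujan_chi q * ramanujan_chi (\<omega> * q) * ramanujan_chi (\<omega>\<^sup>2 * q) =
    (qpochhammer_inf (- q) ?Q * qpochhammer_inf (- (\<omega> * q)) ?Q * qpochhammer_inf (- (\<omega>\<^sup>2 * q)) ?Q) *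
    (qpochhammer_inf (- (q ^ 5)) ?Q * qpochhammer_inf (- ((\<omega> * q) ^ 5)) ?Q * qpochhammer_inf (- ((\<omega>\<^sup>2 * q) ^ 5)) ?Q) * ?x ^ 3"
    unfolding split[OF refl q(2)] split[OF cube_root_multiples(1,3)[OF \<omega>]] split[OF cube_root_multiples(2,4)[OF \<omega>]]
    by (simp add: power3_eq_cube mult_ac)
  then show ?thesis
    unfolding r r5 using e by (simp add: eval_nat_numeral mult_ac)
qed

end

section \<open>Multiplying \<open>theta_phi\<close> over the three cube roots\<close>

context
  fixes q :: "'a::{real_normed_field,banach}"
  assumes q: "q \<noteq> 0" "norm q < 1"
begin

text \<open>Combines the two preceding product formulas through \<open>theta_phi_product\<close>;
  the Euler part is taken at q^2, where squaring only interchanges \<omega> and \<omega>^2.\<close>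

lemma theta_phi_cubic_product:
  assumes \<omega>: "\<omega>\<^sup>2 + \<omega> + 1 = 0"
  shows "theta_phi q * theta_phi (\<omega> * q) * theta_phi (\<omega>\<^sup>2 * q) * theta_phi (q ^ 9) = theta_phi (q ^ 3) ^ 4"
proof -
  have w0: "\<omega> \<noteq> 0" using \<omega> by auto
  have "norm (q ^ 3) < 1" "norm (q ^ 9) < 1" using q by (simp_all add: norm_power power_less_one_iff)
  then have prod3: "theta_phi (q ^ 3) = qpochhammer_inf (q ^ 6) (q ^ 6) * (ramanujan_chi (q ^ 3))\<^sup>2"
    and prod9: "theta_phi (q ^ 9) = qpochhammer_inf (q ^ 18) (q ^ 18) * (ramanujan_chi (q ^ 9))\<^sup>2"
    using theta_phi_product[of "q ^ 3"] theta_phi_product[of "q ^ 9"] q by (simp_all flip: power_mult)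
  have prod: "theta_phi q = qpochhammer_inf (q\<^sup>2) (q\<^sup>2) * (ramanujan_chi q)\<^sup>2"
    by (rule theta_phi_product[OF q])
  have prod1: "theta_phi (\<omega> * q) = qpochhammer_inf (\<omega>\<^sup>2 * q\<^sup>2) (\<omega>\<^sup>2 * q\<^sup>2) * (ramanujan_chi (\<omega> * q))\<^sup>2"
    using theta_phi_product[of "\<omega> * q"] cube_root_multiples[OF q \<omega>] q w0 by (simp add: power_mult_distrib)
  have "\<omega> ^ 4 = \<omega>"
    using power_add[of \<omega> 3 1] cube_root_of_unity[OF \<omega>] by simp
  then have prod2: "theta_phi (\<omega>\<^sup>2 * q) = qpochhammer_inf (\<omega> * q\<^sup>2) (\<omega> * q\<^sup>2) * (ramanujan_chi (\<omega>\<^sup>2 * q))\<^sup>2"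
    using theta_phi_product[of "\<omega>\<^sup>2 * q"] cube_root_multiples[OF q \<omega>] q w0
    by (simp add: power_mult_distrib flip: power_mult)
  have e: "qpochhammer_inf (q\<^sup>2) (q\<^sup>2) * qpochhammer_inf (\<omega> * q\<^sup>2) (\<omega> * q\<^sup>2) *
      qpochhammer_inf (\<omega>\<^sup>2 * q\<^sup>2) (\<omega>\<^sup>2 * q\<^sup>2) * qpochhammer_inf (q ^ 18) (q ^ 18) =
      qpochhammer_inf (q ^ 6) (q ^ 6) ^ 4"
    using euler_function_cubic[OF _ norm_q_square[OF q] \<omega>] q by (simp flip: power_mult)
  have "theta_phi q * theta_phi (\<omega> * q) * theta_phi (\<omega>\<^sup>2 * q) * theta_phi (q ^ 9) =
    (qpochhammer_inf (q\<^sup>2) (q\<^sup>2) * qpochhammer_inf (\<omega> * q\<^sup>2) (\<omega> * q\<^sup>2) *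
      qpochhammer_inf (\<omega>\<^sup>2 * q\<^sup>2) (\<omega>\<^sup>2 * q\<^sup>2) * qpochhammer_inf (q ^ 18) (q ^ 18)) *
    (ramanujan_chi q * ramanujan_chi (\<omega> * q) * ramanujan_chi (\<omega>\<^sup>2 * q) * ramanujan_chi (q ^ 9))\<^sup>2"
    unfolding prod prod1 prod2 prod9 by (simp only: power_mult_distrib mult_ac)
  also have "\<dots> = theta_phi (q ^ 3) ^ 4"
    unfolding e ramanujan_chi_cubic[OF q \<omega>] prod3
    by (simp add: power_mult_distrib flip: power_mult)
  finally show ?thesis .
qed

text \<open>All three trisections share \<open>?A\<close> and \<open>?F\<close>, since these depend
  only on q^3; then (a+b)(a+\<omega>b)(a+\<omega>^2 b) = a^3 + b^3 with b = 2 q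
  \<open>?F\<close>.\<close>

lemma theta_phi_cubic_sum:
  assumes \<omega>: "\<omega>\<^sup>2 + \<omega> + 1 = 0"
  shows "theta_phi q * theta_phi (\<omega> * q) * theta_phi (\<omega>\<^sup>2 * q) =
    theta_phi (q ^ 9) ^ 3 + 8 * q ^ 3 * theta_sum (q ^ 9) (q ^ 6) ^ 3"
proof -
  have w0: "\<omega> \<noteq> 0" using \<omega> by auto
  let ?A = "theta_phi (q ^ 9)" and ?F = "theta_sum (q ^ 9) (q ^ 6)"
  have tri: "theta_phi w = ?A + 2 * w * ?F" if "w \<noteq> 0" "norm w < 1" "w ^ 3 = q ^ 3" for w
  proof -
    have "w ^ 9 = q ^ 9" "w ^ 6 = q ^ 6"
      using that(3) power_mult[of w 3 3] power_mult[of w 3 2] power_mult[of q 3 3] power_mult[of q 3 2] by simp_all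
    then show ?thesis using theta_phi_trisection[OF that(1,2)] by simp
  qed
  have w2: "\<omega>\<^sup>2 = - 1 - \<omega>" using \<omega> by (simp add: algebra_simps eq_neg_iff_add_eq_0)
  have w2': "\<omega> * \<omega> = - 1 - \<omega>" "\<omega> * (\<omega> * y) = (- 1 - \<omega>) * y" for y
    using w2 by (simp_all add: power2_eq_square flip: mult.assoc)
  have *: "(a + b) * (a + \<omega> * b) * (a + \<omega>\<^sup>2 * b) = a ^ 3 + b ^ 3" for a b :: 'a
    unfolding w2 by (simp add: algebra_simps w2' power3_eq_cube)
  have "theta_phi q * theta_phi (\<omega> * q) * theta_phi (\<omega>\<^sup>2 * q) =
      (?A + 2 * q * ?F) * (?A + \<omega> * (2 * q * ?F)) * (?A + \<omega>\<^sup>2 * (2 * q * ?F))"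
    using tri[OF q refl] tri[OF _ cube_root_multiples(3,1)[OF q \<omega>]] tri[OF _ cube_root_multiples(4,2)[OF q \<omega>]] w0 q
    by (simp add: mult_ac)
  then show ?thesis unfolding * by (simp add: power_mult_distrib mult.assoc)
qed

lemma theta_phi_chi_cubic:
  fixes \<omega> :: 'a
  assumes "\<omega>\<^sup>2 + \<omega> + 1 = 0"
  shows "theta_phi (q ^ 3) ^ 4 * ramanujan_chi (q ^ 9) ^ 9 =
    theta_phi (q ^ 9) ^ 4 * (ramanujan_chi (q ^ 9) ^ 9 + 8 * q ^ 3 * ramanujan_chi (q ^ 3) ^ 3)"
proof -
  let ?A = "theta_phi (q ^ 9)" and ?F = "theta_sum (q ^ 9) (q ^ 6)" and ?E = "qpochhammer_inf (q ^ 18) (q ^ 18)"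
    and ?x = "ramanujan_chi (q ^ 3)" and ?y = "ramanujan_chi (q ^ 9)"
  have n: "norm (q ^ 3) < 1" "norm (q ^ 9) < 1" using q by (simp_all add: norm_power power_less_one_iff)
  have F: "?F * ?y = ?E * ?x"
    using theta_sum_cubic_product[of "q ^ 3"] q n by (simp flip: power_mult)
  have A: "?A = ?E * ?y\<^sup>2"
    using theta_phi_product[of "q ^ 9"] q n by (simp flip: power_mult)
  \<comment> \<open>This expresses \<open>?F\<close> through \<open>?A\<close> and the values of
    \<open>ramanujan_chi\<close>, so that it can be eliminated between the product and the sum
    evaluation.\<close>
  have "?F * ?y ^ 3 = (?F * ?y) * ?y\<^sup>2" by (simp add: power2_eq_square power3_eq_cube mult.assoc)
  also have "\<dots> = ?A * ?x" unfolding F A by (simp only: mult_ac)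
  finally have "(?F * ?y ^ 3) ^ 3 = (?A * ?x) ^ 3" by simp
  then have Fy: "?F ^ 3 * ?y ^ 9 = ?A ^ 3 * ?x ^ 3"
    by (simp add: power_mult_distrib flip: power_mult)
  have "theta_phi (q ^ 3) ^ 4 * ?y ^ 9 = (?A ^ 3 + 8 * q ^ 3 * ?F ^ 3) * ?A * ?y ^ 9"
    by (simp only: theta_phi_cubic_product[OF assms, symmetric] theta_phi_cubic_sum[OF assms])
  also have "\<dots> = ?A ^ 3 * ?A * ?y ^ 9 + 8 * q ^ 3 * ?A * (?F ^ 3 * ?y ^ 9)"
    by (simp only: distrib_left distrib_right mult_ac)
  also have "\<dots> = ?A ^ 3 * ?A * (?y ^ 9 + 8 * q ^ 3 * ?x ^ 3)"
    unfolding Fy by (simp only: distrib_left distrib_right mult_ac)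
  also have "?A ^ 3 * ?A = ?A ^ 4" using power_Suc2[of ?A 3] by simp
  finally show ?thesis .
qed

end

subsection \<open>Modular equations of degree three\<close>

text \<open>Apply the identity at the real cube root of q, viewed as a complex number so that a
  primitive \<omega> exists, and return to the reals.\<close>

lemma theta_phi_chi_cubic_real:
  fixes q :: real
  assumes q: "0 < q" "q < 1"
  shows "theta_phi q ^ 4 * ramanujan_chi (q ^ 3) ^ 9 =
    theta_phi (q ^ 3) ^ 4 * (ramanujan_chi (q ^ 3) ^ 9 + 8 * q * ramanujan_chi q ^ 3)"
proof -
  define \<omega> where "\<omega> = Complex (- 1 / 2) (sqrt 3 / 2)"
  have \<omega>: "\<omega>\<^sup>2 + \<omega> + 1 = 0"
    by (simp add: \<omega>_def complex_eq_iff power2_eq_square)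
  define t where "t = root 3 q"
  have t3: "t ^ 3 = q" unfolding t_def using q by (intro real_root_pow_pos2) auto
  have "t ^ 9 = (t ^ 3) ^ 3" by (simp flip: power_mult)
  with t3 have t9: "t ^ 9 = q ^ 3" by simp
  have t: "0 < t" "t < 1" unfolding t_def using q by auto
  have q3: "\<bar>q ^ 3\<bar> < 1" "\<bar>q\<bar> < 1" using q by (auto simp: power_less_one_iff)
  have "theta_phi (complex_of_real t ^ 3) ^ 4 * ramanujan_chi (complex_of_real t ^ 9) ^ 9 =
    theta_phi (complex_of_real t ^ 9) ^ 4 *
      (ramanujan_chi (complex_of_real t ^ 9) ^ 9 + 8 * complex_of_real t ^ 3 * ramanujan_chi (complex_of_real t ^ 3) ^ 3)"
    by (rule theta_phi_chi_cubic[OF _ _ \<omega>]) (use t in auto)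
  then have "complex_of_real (theta_phi q ^ 4 * ramanujan_chi (q ^ 3) ^ 9) =
    complex_of_real (theta_phi (q ^ 3) ^ 4 * (ramanujan_chi (q ^ 3) ^ 9 + 8 * q * ramanujan_chi q ^ 3))"
    unfolding of_real_power[symmetric] t3 t9 theta_phi_of_real[OF q3(1)] theta_phi_of_real[OF q3(2)]
      ramanujan_chi_of_real[OF q3(1)] ramanujan_chi_of_real[OF q3(2)]
    by simp
  then show ?thesis unfolding of_real_eq_iff .
qed

context
  fixes q :: real
  assumes q: "0 < q" "q < 1"
begin

lemma q_nonzero: "q \<noteq> 0" "norm q < 1" "q ^ 3 \<noteq> 0" "norm (q ^ 3) < 1" "norm (q\<^sup>2) < 1"
  using q by (auto simp: power_less_one_iff)

lemma ramanujan_chi_pos: "ramanujan_chi q > 0"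
  unfolding ramanujan_chi_def using q by (intro qpochhammer_inf_pos) (auto simp: power_less_one_iff)

lemma theta_phi_pos: "theta_phi q > 0"
proof -
  have "qpochhammer_inf (q\<^sup>2) (q\<^sup>2) > 0"
    using q by (intro qpochhammer_inf_pos) (auto simp: power_less_one_iff)
  then show ?thesis
    using theta_phi_product[OF q_nonzero(1,2)] ramanujan_chi_pos by simp
qed

lemma borwein_a_nonneg: "borwein_a q \<ge> 0"
  unfolding borwein_a_def using q by (intro infsum_nonneg) auto

text \<open>Jacobi's quartic identity. With a, s the values of \<open>theta_phi\<close> and
  \<open>theta_psi2\<close> at q^2, it is (a^2 + q s^2)^2 - (a^2 - q s^2)^2 = q (2 a s)^2.\<close>

lemma theta_phi_fourth_power: "theta_phi q ^ 4 = theta_phi (- q) ^ 4 + q * theta_psi2 q ^ 4"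
proof -
  have "(theta_phi q)\<^sup>2 = (theta_phi (q\<^sup>2))\<^sup>2 + q * (theta_psi2 (q\<^sup>2))\<^sup>2"
    "(theta_phi (- q))\<^sup>2 = (theta_phi (q\<^sup>2))\<^sup>2 - q * (theta_psi2 (q\<^sup>2))\<^sup>2"
    using theta_phi_square[of q] theta_phi_square[of "- q"] q_nonzero by simp_all
  moreover have "(theta_psi2 q)\<^sup>2 = 2 * theta_phi (q\<^sup>2) * theta_psi2 (q\<^sup>2)"
    by (rule theta_psi2_square) (fact q_nonzero)+
  moreover have "x ^ 4 = (x\<^sup>2)\<^sup>2" for x :: real by simp
  ultimately show ?thesis by (simp only:) (simp add: power2_eq_square algebra_simps)
qed

end

text \<open>Writing everything through theta values at q^2 and q^6 gives twice the left side as A^2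
  B^2 + A'^2 B'^2 + P^2; the cubic relation AB = A'B' + P then removes the last two squares.\<close>

lemma borwein_a_square:
  fixes q :: real
  assumes q: "0 < q" "q < 1"
  defines "P \<equiv> q * (theta_psi2 q * theta_psi2 (q ^ 3))"
  shows "(borwein_a (q\<^sup>2))\<^sup>2 = (theta_phi q * theta_phi (q ^ 3))\<^sup>2 - theta_phi (- q) * theta_phi (- (q ^ 3)) * P"
proof -
  note nz = q_nonzero[OF q]
  let ?A = "theta_phi q" and ?A' = "theta_phi (- q)" and ?B = "theta_phi (q ^ 3)" and ?B' = "theta_phi (- (q ^ 3))"
  let ?a = "theta_phi (q\<^sup>2)" and ?b = "theta_phi ((q ^ 3)\<^sup>2)" and ?s = "theta_psi2 (q\<^sup>2)" and ?t = "theta_psi2 ((q ^ 3)\<^sup>2)"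
  have eq: "(q\<^sup>2) ^ 3 = (q ^ 3)\<^sup>2" by (simp flip: power_mult)
  have 1: "borwein_a (q\<^sup>2) = ?a * ?b + q\<^sup>2 * (?s * ?t)"
    using borwein_a_eq[of "q\<^sup>2"] nz unfolding eq by simp
  have 2: "?A\<^sup>2 = ?a\<^sup>2 + q * ?s\<^sup>2" "?A'\<^sup>2 = ?a\<^sup>2 - q * ?s\<^sup>2"
    using theta_phi_square[of q] theta_phi_square[of "- q"] nz by simp_all
  have 3: "?B\<^sup>2 = ?b\<^sup>2 + q ^ 3 * ?t\<^sup>2" "?B'\<^sup>2 = ?b\<^sup>2 - q ^ 3 * ?t\<^sup>2"
    using theta_phi_square[of "q ^ 3"] theta_phi_square[of "- (q ^ 3)"] nz by simp_all
  have 4: "(theta_psi2 q)\<^sup>2 = 2 * ?a * ?s" "(theta_psi2 (q ^ 3))\<^sup>2 = 2 * ?b * ?t"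
    using theta_psi2_square[of q] theta_psi2_square[of "q ^ 3"] nz by simp_all
  have "2 * (borwein_a (q\<^sup>2))\<^sup>2 = ?A\<^sup>2 * ?B\<^sup>2 + ?A'\<^sup>2 * ?B'\<^sup>2 + P\<^sup>2"
    unfolding 1 P_def power_mult_distrib 2 3 4
    by (simp add: power2_eq_square power3_eq_cube algebra_simps)
  moreover have "?A * ?B = ?A' * ?B' + P"
    unfolding P_def by (rule theta_phi_cubic) (use nz in auto)
  then have "?A'\<^sup>2 * ?B'\<^sup>2 + P\<^sup>2 = (?A * ?B)\<^sup>2 - 2 * (?A' * ?B' * P)"
    by (simp add: power2_eq_square algebra_simps)
  ultimately show ?thesis by (simp add: power_mult_distrib)
qed

text \<open>For the moduli \<open>\<alpha>\<close>, \<open>\<beta>\<close> of \<open>q\<close> and \<open>q ^ 3\<close>, the hypothesis \<open>u + v = 1\<close> is the classical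
  modular equation of degree 3.\<close>
lemma modular_equation_sum_squares:
  fixes \<alpha> \<beta> u v :: real
  assumes "u + v = 1" "\<alpha> * \<beta> = u ^ 4" "(1 - \<alpha>) * (1 - \<beta>) = v ^ 4"
  shows "\<alpha> * (1 - \<alpha>) + \<beta> * (1 - \<beta>) + 2 * (u * v)\<^sup>2 = 4 * (u * v) * (1 - 2 * (u * v))\<^sup>2"
proof -
  have v: "v = 1 - u" using assms(1) by simp
  \<comment> \<open>Sum and product of \<alpha>, \<beta> are now polynomials in \<open>u\<close>,
    and the symmetric claim reduces to a polynomial identity.\<close>
  have s: "\<alpha> + \<beta> = 1 + u ^ 4 - v ^ 4"
    using assms(2,3) by (simp add: algebra_simps)
  have "\<alpha> * (1 - \<alpha>) + \<beta> * (1 - \<beta>) = (\<alpha> + \<beta>) * (1 - (\<alpha> + \<beta>)) + 2 * (\<alpha> * \<beta>)"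
    by (simp add: algebra_simps)
  then show ?thesis
    unfolding s assms(2) v by (simp add: power2_eq_square eval_nat_numeral algebra_simps)
qed

lemma borwein_a_over_theta_phi_square:
  fixes q :: real
  assumes q: "0 < q" "q < 1"
  defines "X \<equiv> q * ramanujan_chi q ^ 3 / ramanujan_chi (q ^ 3) ^ 9"
    and "Y \<equiv> ramanujan_chi (q ^ 3) ^ 3 / ramanujan_chi q ^ 9"
  shows "borwein_a (q\<^sup>2) / (theta_phi q)\<^sup>2 = 1 / 3 * (1 + 8 * X) powr (1 / 4) * (1 + 2 * Y)"
proof -
  have q3: "0 < q ^ 3" "q ^ 3 < 1" and q2: "0 < q\<^sup>2" "q\<^sup>2 < 1"
    using q by (auto simp: power_less_one_iff)
  define A B A' B' S T x y where defs: "A = theta_phi q" "B = theta_phi (q ^ 3)"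
    "A' = theta_phi (- q)" "B' = theta_phi (- (q ^ 3))" "S = theta_psi2 q" "T = theta_psi2 (q ^ 3)"
    "x = ramanujan_chi q" "y = ramanujan_chi (q ^ 3)"
  have pos: "0 < A" "0 < B" "0 < x" "0 < y"
    unfolding defs using q q3 by (auto intro: theta_phi_pos ramanujan_chi_pos)
  have A4: "A ^ 4 = A' ^ 4 + q * S ^ 4" and B4: "B ^ 4 = B' ^ 4 + q ^ 3 * T ^ 4"
    unfolding defs by (rule theta_phi_fourth_power[OF q] theta_phi_fourth_power[OF q3])+
  have AB: "A * B = A' * B' + q * S * T"
    unfolding defs using theta_phi_cubic[of q] q by (simp add: mult.assoc)
  have x6: "x ^ 6 * S * A' = 2 * A\<^sup>2" and y6: "y ^ 6 * T * B' = 2 * B\<^sup>2"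
    unfolding defs using ramanujan_chi_power_6[of q] ramanujan_chi_power_6[of "q ^ 3"] q q3 by auto
  \<comment> \<open>For \<open>S\<close>, \<open>T\<close>, \<open>A'\<close>, \<open>B'\<close>
    this follows from the nonzero right-hand sides of \<open>x6\<close> and
    \<open>y6\<close>.\<close>
  have nz: "S \<noteq> 0" "T \<noteq> 0" "A' \<noteq> 0" "B' \<noteq> 0" "A \<noteq> 0" "B \<noteq> 0" "x \<noteq> 0" "y \<noteq> 0" "q \<noteq> 0"
    using x6 y6 pos q by auto
  have X: "X = q * x ^ 3 / y ^ 9" and Y: "Y = y ^ 3 / x ^ 9"
    by (simp_all add: X_def Y_def defs)
  have XY_pos: "0 < X" "0 < Y" unfolding X Y using pos q by auto
  have m2: "1 + 8 * X = A ^ 4 / B ^ 4"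
    using theta_phi_chi_cubic_real[OF q] nz unfolding X defs by (simp add: field_simps)
  \<comment> \<open>With moduli \<alpha> = q S^4/A^4 and \<beta> = q^3 T^4/B^4, these are fourth
    roots of \<alpha>\<beta> and (1-\<alpha>)(1-\<beta>); their product is the p of the
    overview.\<close>
  define u v where "u = q * S * T / (A * B)" and "v = A' * B' / (A * B)"
  have uv: "u + v = 1"
  proof -
    have "u + v = A * B / (A * B)"
      unfolding u_def v_def by (simp only: AB add_divide_distrib add.commute)
    then show ?thesis using nz by simp
  qed
  have \<alpha>: "1 - q * S ^ 4 / A ^ 4 = A' ^ 4 / A ^ 4" and \<beta>: "1 - q ^ 3 * T ^ 4 / B ^ 4 = B' ^ 4 / B ^ 4"
  proof -
    have "A' ^ 4 = A ^ 4 - q * S ^ 4" "B' ^ 4 = B ^ 4 - q ^ 3 * T ^ 4" using A4 B4 by simp_all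
    then show "1 - q * S ^ 4 / A ^ 4 = A' ^ 4 / A ^ 4" "1 - q ^ 3 * T ^ 4 / B ^ 4 = B' ^ 4 / B ^ 4"
      using nz by (simp_all add: diff_divide_distrib)
  qed
  have "q * S ^ 4 / A ^ 4 * (q ^ 3 * T ^ 4 / B ^ 4) = u ^ 4"
    by (simp add: u_def power_mult_distrib power_divide eval_nat_numeral mult_ac)
  moreover have "(1 - q * S ^ 4 / A ^ 4) * (1 - q ^ 3 * T ^ 4 / B ^ 4) = v ^ 4"
    unfolding \<alpha> \<beta> by (simp add: v_def power_mult_distrib power_divide)
  ultimately have quad: "q * S ^ 4 / A ^ 4 * (A' ^ 4 / A ^ 4) + q ^ 3 * T ^ 4 / B ^ 4 * (B' ^ 4 / B ^ 4) + 2 * (u * v)\<^sup>2 =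
      4 * (u * v) * (1 - 2 * (u * v))\<^sup>2"
    using modular_equation_sum_squares[OF uv, of "q * S ^ 4 / A ^ 4" "q ^ 3 * T ^ 4 / B ^ 4"]
    unfolding \<alpha> \<beta> by blast
  define a b s t where "a = A\<^sup>2" "b = B\<^sup>2" "s = S * A'" "t = T * B'"
  note abst = this
  have nz': "a \<noteq> 0" "b \<noteq> 0" "s \<noteq> 0" "t \<noteq> 0" using nz by (simp_all add: abst)
  have x6': "x ^ 6 = 2 * a / s" and y6': "y ^ 6 = 2 * b / t"
    using x6 y6 nz' nz unfolding abst by (simp_all add: divide_simps mult_ac)
  have uv': "u * v = q * s * t / (a * b)"
    unfolding u_def v_def abst by (simp add: power2_eq_square mult_ac)
  \<comment> \<open>Squaring leaves only x^6 and y^6, which are rational in a, b, s, t. Hence 4uv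
    X^2 = \<beta>(1-\<beta>) and 4uv Y^2 = \<alpha>(1-\<alpha>), the first two terms in
    \<open>quad\<close>.\<close>
  have "X\<^sup>2 = q\<^sup>2 * x ^ 6 / (y ^ 6) ^ 3" "Y\<^sup>2 = y ^ 6 / (x ^ 6) ^ 3"
    unfolding X Y by (simp_all add: power_divide power_mult_distrib flip: power_mult)
  then have "4 * (u * v) * X\<^sup>2 = q ^ 3 * t ^ 4 / b ^ 4"
    and "4 * (u * v) * Y\<^sup>2 = q * s ^ 4 / a ^ 4"
    unfolding x6' y6' uv' using nz' by (simp_all add: power_divide power_mult_distrib)
      (simp_all add: divide_simps power2_eq_square power3_eq_cube power4_eq_xxxx)
  then have X2: "4 * (u * v) * X\<^sup>2 = q ^ 3 * T ^ 4 / B ^ 4 * (B' ^ 4 / B ^ 4)"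
    and Y2: "4 * (u * v) * Y\<^sup>2 = q * S ^ 4 / A ^ 4 * (A' ^ 4 / A ^ 4)"
    unfolding abst by (simp_all add: power_mult_distrib flip: power_mult power_add)
  have "X * Y = q * (x ^ 3 * y ^ 3) / ((x ^ 3 * y ^ 3) * (x ^ 6 * y ^ 6))"
    unfolding X Y by (simp add: mult_ac flip: power_add)
  also have "\<dots> = q / (x ^ 6 * y ^ 6)" using nz by simp
  finally have XY: "X * Y = u * v / 4"
    unfolding x6' y6' uv' using nz' by simp
  have "4 * (u * v) * (X + Y)\<^sup>2 = 4 * (u * v) * X\<^sup>2 + 4 * (u * v) * Y\<^sup>2 + 8 * (u * v) * (X * Y)"
    by (simp add: power2_eq_square algebra_simps)
  also have "\<dots> = 4 * (u * v) * (1 - 2 * (u * v))\<^sup>2"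
    unfolding X2 Y2 XY quad[symmetric] by (simp add: power2_eq_square)
  finally have "(X + Y)\<^sup>2 = (1 - 2 * (u * v))\<^sup>2"
    using nz nz' unfolding uv' by simp
  \<comment> \<open>Being a sum of squares, this side is nonnegative; as X + Y is positive, the
    squares may be dropped.\<close>
  moreover have "1 - 2 * (u * v) = u\<^sup>2 + v\<^sup>2"
  proof -
    have "(u + v)\<^sup>2 = 1" using uv by simp
    then show ?thesis by (simp add: power2_eq_square algebra_simps)
  qed
  ultimately have sum: "X + Y = 1 - 2 * (u * v)"
    using XY_pos by (auto intro: power2_eq_imp_eq)
  have "(1 + 8 * X) * (1 + 8 * Y) = 1 + 8 * (X + Y) + 64 * (X * Y)"
    by (simp add: algebra_simps)
  also have "\<dots> = 9" unfolding sum XY by simp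
  finally have Y9: "1 + 8 * Y = 9 * B ^ 4 / A ^ 4"
    unfolding m2 using nz by (simp add: divide_simps mult_ac)
  let ?a = "borwein_a (q\<^sup>2)"
  have "?a\<^sup>2 = (A * B)\<^sup>2 - A' * B' * (q * (S * T))"
    unfolding defs by (rule borwein_a_square[OF q])
  also have "\<dots> = (A * B)\<^sup>2 * (1 - u * v)"
    using nz by (simp add: u_def v_def right_diff_distrib power2_eq_square)
  \<comment> \<open>With m = A^2/B^2 the right side is m^2 + 9/m^2 + 6 = (m + 3/m)^2, a perfect
    square, so the root for \<open>?a\<close> is rational in A and B.\<close>
  also have "16 * (1 - u * v) = (1 + 8 * X) + (1 + 8 * Y) + 6"
    using sum by simp
  then have "1 - u * v = (A ^ 4 / B ^ 4 + 9 * B ^ 4 / A ^ 4 + 6) / 16"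
    unfolding m2 Y9 by simp
  also have "(A * B)\<^sup>2 * \<dots> = ((A ^ 4 + 3 * B ^ 4) / (4 * A * B))\<^sup>2"
    using nz by (simp add: divide_simps) (simp add: power2_eq_square eval_nat_numeral algebra_simps)
  finally have a_eq: "?a = (A ^ 4 + 3 * B ^ 4) / (4 * A * B)"
    using borwein_a_nonneg[OF q2] pos by (auto intro: power2_eq_imp_eq)
  have "A ^ 4 / B ^ 4 = (A / B) powr 4"
    using pos by (simp add: power_divide)
  then have "(1 + 8 * X) powr (1 / 4) = ((A / B) powr 4) powr (1 / 4)"
    unfolding m2 by (rule arg_cong)
  also have "\<dots> = A / B" unfolding powr_powr using pos by simp
  finally have root: "(1 + 8 * X) powr (1 / 4) = A / B" .
  have "1 + 2 * Y = (3 + 9 * B ^ 4 / A ^ 4) / 4" using Y9 by simp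
  then show ?thesis
    unfolding root a_eq defs(1)[symmetric] using nz
    by (simp add: divide_simps) (simp add: power2_eq_square power4_eq_xxxx algebra_simps)
qed

text \<open>Passing from n to 9n replaces q by q^3, so only the normalizing factors of the class
  invariants have to be compared with X and Y.\<close>

theorem theorem6p1:
  fixes n :: rat
  assumes "n > 0"
  shows "borwein_a (exp (- 2 * pi * sqrt (of_rat n))) / (theta_phi (exp (- pi * sqrt (of_rat n))))\<^sup>2
    = 1 / 3
      * (1 + 2 * sqrt 2 * class_invariant_G n ^ 3 / class_invariant_G (9 * n) ^ 9) powr (1 / 4)
      * (1 + sqrt 2 * class_invariant_G (9 * n) ^ 3 / (2 * class_invariant_G n ^ 9))"
proof -
  define q where "q = exp (- pi * sqrt (of_rat n))"
  have q: "0 < q" "q < 1" using assms by (auto simp: q_def)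
  have q2: "exp (- 2 * pi * sqrt (of_rat n)) = q\<^sup>2"
    by (simp add: q_def flip: exp_of_nat_mult)
  have "sqrt (of_rat (9 * n)) = 3 * sqrt (of_rat n)"
    by (simp add: of_rat_mult real_sqrt_mult)
  then have q3: "exp (- pi * sqrt (of_rat (9 * n))) = q ^ 3"
    by (simp add: q_def flip: exp_of_nat_mult)
  define x y where "x = ramanujan_chi q" and "y = ramanujan_chi (q ^ 3)"
  have pos: "0 < x" "0 < y"
    unfolding x_def y_def using q by (auto intro!: ramanujan_chi_pos simp: power_less_one_iff)
  \<comment> \<open>The invariants are g h x and g h^3 y. In G_n^3 / G_{9n}^9 there remains 1/(g^6
    h^24) = 2 sqrt(2) q, which produces the 8 q.\<close>
  define g h where "g = (2::real) powr (- 1 / 4)" and "h = q powr (- 1 / 24)"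
  have gh: "g > 0" "h > 0" using q by (auto simp: g_def h_def)
  have g2: "g\<^sup>2 = 1 / sqrt 2"
    by (simp add: g_def powr_power powr_minus powr_half_sqrt divide_simps)
  have h24: "h ^ 24 = 1 / q"
    using q by (simp add: h_def powr_power powr_minus divide_simps)
  have h3: "(q ^ 3) powr (- 1 / 24) = h ^ 3"
    using q by (simp add: h_def powr_power powr_powr flip: powr_numeral)
  have G1: "class_invariant_G n = g * h * x"
    unfolding class_invariant_G_def Let_def q_def[symmetric] by (simp add: g_def h_def x_def)
  have G9: "class_invariant_G (9 * n) = g * h ^ 3 * y"
    unfolding class_invariant_G_def Let_def q3 h3 by (simp add: g_def y_def)
  have g6: "g ^ 6 = 1 / (2 * sqrt 2)"
  proof -
    have "g ^ 6 = (g\<^sup>2) ^ 3" by (simp flip: power_mult)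
    also have "\<dots> = 1 / (2 * sqrt 2)" unfolding g2 by (simp add: power_divide power3_eq_cube)
    finally show ?thesis .
  qed
  have "(g * h * x) ^ 3 = g ^ 3 * h ^ 3 * x ^ 3"
    and "(g * h ^ 3 * y) ^ 9 = g ^ 3 * h ^ 3 * (g ^ 6 * h ^ 24 * y ^ 9)"
    by (simp_all add: power_mult_distrib mult_ac flip: power_mult)
  then have "2 * sqrt 2 * class_invariant_G n ^ 3 / class_invariant_G (9 * n) ^ 9 =
      2 * sqrt 2 * x ^ 3 / (g ^ 6 * h ^ 24 * y ^ 9)"
    unfolding G1 G9 using gh by simp
  also have "\<dots> = 8 * (q * x ^ 3 / y ^ 9)"
    unfolding g6 h24 using pos q by (simp add: field_simps)
  finally have X: "2 * sqrt 2 * class_invariant_G n ^ 3 / class_invariant_G (9 * n) ^ 9 = 8 * (q * x ^ 3 / y ^ 9)" .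
  \<comment> \<open>Here numerator and denominator both carry h^9, so no power of q
    survives.\<close>
  have "sqrt 2 * class_invariant_G (9 * n) ^ 3 / (2 * class_invariant_G n ^ 9) = sqrt 2 * y ^ 3 / (2 * g ^ 6 * x ^ 9)"
    unfolding G1 G9 using gh pos by (simp add: field_simps power_mult_distrib flip: power_mult power_add)
  also have "\<dots> = 2 * (y ^ 3 / x ^ 9)"
    unfolding g6 using pos by (simp add: field_simps)
  finally have Y: "sqrt 2 * class_invariant_G (9 * n) ^ 3 / (2 * class_invariant_G n ^ 9) = 2 * (y ^ 3 / x ^ 9)" .
  show ?thesis
    unfolding X Y q2 q_def[symmetric] x_def y_def by (rule borwein_a_over_theta_phi_square[OF q])
qed

end
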